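(* Let $I$ be a compact interval and $f\colon I\to I$ a continuous map. If $f$ is chaotic in the sense of Wiggins, then $f$ is chaotic in the sense of Li-Yorke.
   Context: Let $X$ be a metric space with distance $d$ and $T\colon X\to X$ continuous. $T$ is transitive if for all nonempty open subsets $U,V$ of $X$ there is an integer $n\ge 0$ with $T^{-n}(U)\cap V\neq\emptyset$. $T$ is sensitive if there is $\delta>0$ such that for all $x\in X$ and all neighbourhoods $U$ of $x$ there exist $y\in U$ and $n\ge 0$ with $d(T^n(x),T^n(y))\ge\delta$. A subset $Y\subset X$ is invariant if $T(Y)\subset Y$. $T$ is chaotic in the sense of Wiggins if there exists a nonempty closed invariant subset $Y\subset X$ such that the restriction $T|_Y\colon Y\to Y$ is transitive and sensitive. $T$ is chaotic in the sense of Li-Yorke if there exists an uncountable set $S\subset X$ such that for all $x,y\in S$ with $x\ne y$ one has $\limsup_{n\to+\infty}d(T^n(x),T^n(y))>0$ and $\liminf_{n\to+\infty}d(T^n(x),T^n(y))=0$. *)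

theory Defs
  imports "HOL-Analysis.Analysis"
begin

text \<open>
  A dynamical system is given by a carrier set \<open>X\<close> in a metric space, with the induced
  distance and the subspace topology, together with a total function \<open>T\<close> that maps \<open>X\<close> into
  itself; only the values of \<open>T\<close> on \<open>X\<close> matter.  The restriction of \<open>T\<close> to an invariant
  subset \<open>Y\<close> is the system with carrier \<open>Y\<close> and the same function \<open>T\<close>.
\<close>

definition transitive_map :: "'a::metric_space set \<Rightarrow> ('a \<Rightarrow> 'a) \<Rightarrow> bool" where
  "transitive_map X T \<longleftrightarrow>
    (\<forall>U V. openin (top_of_set X) U \<and> U \<noteq> {} \<and> openin (top_of_set X) V \<and> V \<noteq> {} \<longrightarrow>
      (\<exists>n. (T ^^ n) -` U \<inter> V \<noteq> {}))"

text \<open>Neighbourhoods are relative to \<open>X\<close> and need not be open.\<close>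

definition neighbourhood_in :: "'a::metric_space set \<Rightarrow> 'a \<Rightarrow> 'a set \<Rightarrow> bool" where
  "neighbourhood_in X x U \<longleftrightarrow>
    U \<subseteq> X \<and> (\<exists>W. openin (top_of_set X) W \<and> x \<in> W \<and> W \<subseteq> U)"

definition sensitive_map :: "'a::metric_space set \<Rightarrow> ('a \<Rightarrow> 'a) \<Rightarrow> bool" where
  "sensitive_map X T \<longleftrightarrow>
    (\<exists>\<delta>>0. \<forall>x\<in>X. \<forall>U. neighbourhood_in X x U \<longrightarrow>
      (\<exists>y\<in>U. \<exists>n. dist ((T ^^ n) x) ((T ^^ n) y) \<ge> \<delta>))"

definition wiggins_chaotic :: "'a::metric_space set \<Rightarrow> ('a \<Rightarrow> 'a) \<Rightarrow> bool" where
  "wiggins_chaotic X T \<longleftrightarrow>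
    (\<exists>Y. Y \<noteq> {} \<and> closedin (top_of_set X) Y \<and> T ` Y \<subseteq> Y \<and>
      transitive_map Y T \<and> sensitive_map Y T)"

text \<open>
  The upper and lower limits are taken in the extended reals, so that they exist even if the
  distances are unbounded.
\<close>

definition li_yorke_chaotic :: "'a::metric_space set \<Rightarrow> ('a \<Rightarrow> 'a) \<Rightarrow> bool" where
  "li_yorke_chaotic X T \<longleftrightarrow>
    (\<exists>S\<subseteq>X. uncountable S \<and>
      (\<forall>x\<in>S. \<forall>y\<in>S. x \<noteq> y \<longrightarrow>
        limsup (\<lambda>n. ereal (dist ((T ^^ n) x) ((T ^^ n) y))) > 0 \<and>
        liminf (\<lambda>n. ereal (dist ((T ^^ n) x) ((T ^^ n) y))) = 0))"

end

theory Submission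
  imports Defs
begin

text \<open>
  Extend \<open>f\<close> to a continuous \<open>F\<close> on the line by clamping.  Li-Yorke chaos follows from two points
  \<open>u \<noteq> v\<close> such that, at a common time, the images of any given neighbourhoods of \<open>u\<close> and of \<open>v\<close> both
  cover neighbourhoods of \<open>u\<close> and \<open>v\<close>.

  The iterates of a small interval around a point of the chaotic set \<open>Y\<close> fill up a cycle of
  disjoint intervals, and \<open>F ^^ p\<close>, where \<open>p\<close> is the length of the cycle, has a fixed point \<open>z\<close>
  between two points of \<open>Y\<close> in the same interval of the cycle; all late iterates at multiples of \<open>p\<close>
  contain \<open>z\<close>.  If \<open>p\<close> stays bounded, then any small intervals around two points of \<open>Y\<close> on the
  same side of \<open>z\<close> cover each other, which gives \<open>u\<close> and \<open>v\<close>.  If \<open>p\<close> is unbounded, then by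
  sensitivity the cycles do not shrink to points, and a limit argument gives two adjacent points
  \<open>u < v\<close> of \<open>Y\<close> that are never separated; the fixed points of the cycles around them, together
  with the returns of \<open>Y\<close> to both sides of the gap, give the common covering times.
\<close>

section \<open>Intermediate values and iterates of maps of the line\<close>

lemma connected_real_between:
  fixes S :: "real set"
  assumes "connected S" "s \<in> S" "t \<in> S" "s \<le> x" "x \<le> t"
  shows "x \<in> S"
  using assms connected_contains_Icc[of S s t] by auto

lemma continuous_funpow:
  fixes F :: "'a::topological_space \<Rightarrow> 'a"
  assumes "continuous_on UNIV F"
  shows "continuous_on UNIV (F ^^ n)"
proof (induction n)
  case 0
  show ?case by (simp add: id_def)
next
  case (Suc n)
  have "continuous_on UNIV (F \<circ> (F ^^ n))"
    using Suc assms continuous_on_compose continuous_on_subset by blast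
  then show ?case by simp
qed

lemma fixed_point_between:
  fixes g :: "real \<Rightarrow> real"
  assumes g: "continuous_on UNIV g" and y: "g y > y" and t: "g t < t"
  shows "\<exists>z. g z = z \<and> (y < z \<and> z < t \<or> t < z \<and> z < y)"
proof -
  let ?h = "\<lambda>x. g x - x"
  have h: "continuous_on S ?h" for S
    by (intro continuous_intros continuous_on_subset[OF g]) auto
  have ne: "z \<noteq> y" "z \<noteq> t" if "?h z = 0" for z
    using that y t by auto
  show ?thesis
  proof (cases "y \<le> t")
    case True
    have "\<exists>z\<ge>y. z \<le> t \<and> ?h z = 0"
      by (rule IVT2') (use True y t h in auto)
    then obtain z where z: "y \<le> z" "z \<le> t" "?h z = 0" by blast
    then show ?thesis using ne[of z] by (intro exI[of _ z]) auto
  next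
    case False
    have "\<exists>z\<ge>t. z \<le> y \<and> ?h z = 0"
      by (rule IVT') (use False y t h in auto)
    then obtain z where z: "t \<le> z" "z \<le> y" "?h z = 0" by blast
    then show ?thesis using ne[of z] by (intro exI[of _ z]) auto
  qed
qed

text \<open>Otherwise \<open>a\<close> would be nondecreasing. The comparison starts at index 1
  because it is applied to an orbit that jumps up in its first step and is back near its start at
  time \<open>k\<close>.\<close>

lemma descent_step:
  fixes a :: "nat \<Rightarrow> real"
  assumes "a 1 > a k" "k \<ge> 1"
  shows "\<exists>j. a (Suc j) < a j"
proof (rule ccontr)
  assume "\<not> ?thesis"
  then have "a n \<le> a (Suc n)" for n by (simp add: not_less)
  then have "a 1 \<le> a k" using assms(2) lift_Suc_mono_le by blast
  then show False using assms by simp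
qed

lemma ascent_step:
  fixes a :: "nat \<Rightarrow> real"
  assumes "a 1 < a k" "k \<ge> 1"
  shows "\<exists>j. a (Suc j) > a j"
  using descent_step[of "\<lambda>n. - a n" k] assms by auto

lemma funpow_fixed:
  assumes "(F ^^ p) z = z" "p dvd n"
  shows "(F ^^ n) z = z"
proof -
  obtain k where "n = p * k" using assms(2) by blast
  moreover have "((F ^^ p) ^^ k) z = z" by (induction k) (auto simp: assms(1))
  ultimately show ?thesis by (simp add: funpow_mult)
qed

lemma funpow_image_add: "(F ^^ (m + n)) ` A = (F ^^ m) ` (F ^^ n) ` A"
  by (simp add: funpow_add image_comp)

lemma funpow_add_apply: "(F ^^ (m + n)) x = (F ^^ m) ((F ^^ n) x)"
  by (simp add: funpow_add)

section \<open>A criterion for Li-Yorke chaos\<close>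

text \<open>Realizes an itinerary: the points of \<open>A 0\<close> that visit \<open>A j\<close> at
  time \<open>T j\<close> for all \<open>j \<le> k\<close> form decreasing compact sets
  \<open>K k\<close>. They are nonempty because \<open>F ^^ T k\<close> maps \<open>K k\<close> over
  all of \<open>A k\<close>.\<close>

lemma compact_chain:
  fixes F :: "real \<Rightarrow> real" and A :: "nat \<Rightarrow> real set"
  assumes cont: "continuous_on UNIV F" and A: "\<And>k. compact (A k)" "A 0 \<noteq> {}"
    and cover: "\<And>k. A (Suc k) \<noteq> {} \<and> A (Suc k) \<subseteq> (F ^^ n k) ` A k"
  shows "\<exists>x. \<forall>k. (F ^^ (\<Sum>i<k. n i)) x \<in> A k"
proof -
  define T where "T k = (\<Sum>i<k. n i)" for k
  \<comment> \<open>As \<open>T 0 = 0\<close>, the factor \<open>A 0\<close> repeats the condition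
    for \<open>j = 0\<close>; it is there to make the closed intersection compact.\<close>
  define K where "K k = A 0 \<inter> (\<Inter>j\<in>{..k}. (F ^^ T j) -` A j)" for k
  have pre: "closed ((F ^^ j) -` A i)" for i j
    using continuous_funpow[OF cont, of j] compact_imp_closed[OF A(1)]
    by (simp add: continuous_on_closed_vimage)
  have compK: "compact (K k)" for k
    unfolding K_def by (intro compact_Int_closed A closed_INT ballI pre)
  have sub: "A k \<subseteq> (F ^^ T k) ` K k" for k
  proof (induction k)
    case 0
    show ?case by (auto simp: K_def T_def)
  next
    case (Suc k)
    show ?case
    proof
      fix y assume y: "y \<in> A (Suc k)"
      then obtain s where "s \<in> A k" "y = (F ^^ n k) s" using cover by blast
      then obtain x where x: "x \<in> K k" "y = (F ^^ n k) ((F ^^ T k) x)" using Suc by blast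
      then have "y = (F ^^ T (Suc k)) x" by (simp add: T_def add.commute flip: funpow_add_apply)
      moreover have "x \<in> K (Suc k)" using x(1) y calculation by (auto simp: K_def le_Suc_eq)
      ultimately show "y \<in> (F ^^ T (Suc k)) ` K (Suc k)" by blast
    qed
  qed
  have "A k \<noteq> {}" for k using A(2) cover by (cases k) auto
  then have "K k \<noteq> {}" for k using sub[of k] by auto
  then have "\<Inter> (range K) \<noteq> {}"
    by (intro compact_nest) (use compK in \<open>auto simp: K_def\<close>)
  then show ?thesis by (auto simp: K_def T_def)
qed

lemma limsup_pos_if_not_tendsto:
  fixes d :: "nat \<Rightarrow> real"
  assumes "\<And>n. d n \<ge> 0" "\<not> d \<longlonglongrightarrow> 0"
  shows "limsup (\<lambda>n. ereal (d n)) > 0"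
proof (rule ccontr)
  assume "\<not> ?thesis"
  then have "limsup (\<lambda>n. ereal (d n)) \<le> 0" by simp
  moreover have "0 \<le> liminf (\<lambda>n. ereal (d n))"
    by (intro Liminf_bounded) (simp add: assms)
  ultimately have "(\<lambda>n. ereal (d n)) \<longlonglongrightarrow> ereal 0"
    using Liminf_le_Limsup[of sequentially "\<lambda>n. ereal (d n)"]
    by (intro Liminf_eq_Limsup) (auto simp: zero_ereal_def[symmetric])
  then show False using assms(2) by (simp add: lim_ereal)
qed

lemma liminf_zero_if_subseq:
  fixes d :: "nat \<Rightarrow> real"
  assumes "\<And>n. d n \<ge> 0" "strict_mono r" "(\<lambda>k. d (r k)) \<longlonglongrightarrow> 0"
  shows "liminf (\<lambda>n. ereal (d n)) = 0"
proof (rule antisym)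
  have "((\<lambda>n. ereal (d n)) \<circ> r) \<longlonglongrightarrow> ereal 0" using assms(3) by (simp add: o_def)
  then have "liminf ((\<lambda>n. ereal (d n)) \<circ> r) = 0"
    using lim_imp_Liminf[of sequentially] by (simp add: zero_ereal_def)
  then show "liminf (\<lambda>n. ereal (d n)) \<le> 0"
    using liminf_subseq_mono[OF assms(2), of "\<lambda>n. ereal (d n)"] by simp
  show "0 \<le> liminf (\<lambda>n. ereal (d n))"
    by (intro Liminf_bounded) (simp add: assms)
qed

text \<open>Since distances are nonnegative, the failure of this relation amounts to the positive
  upper limit required of a scrambled pair.\<close>

definition asymptotic :: "(real \<Rightarrow> real) \<Rightarrow> real \<Rightarrow> real \<Rightarrow> bool" where
  "asymptotic F x y \<longleftrightarrow> (\<lambda>n. dist ((F ^^ n) x) ((F ^^ n) y)) \<longlonglongrightarrow> 0"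

lemma asymptotic_sym: "asymptotic F x y \<Longrightarrow> asymptotic F y x"
  by (simp add: asymptotic_def dist_commute)

lemma asymptotic_trans:
  assumes "asymptotic F x y" "asymptotic F y z"
  shows "asymptotic F x z"
proof -
  let ?d = "\<lambda>x y n. dist ((F ^^ n) x) ((F ^^ n) y)"
  have "(\<lambda>n. ?d x y n + ?d y z n) \<longlonglongrightarrow> 0"
    using tendsto_add[of "?d x y" 0 sequentially "?d y z" 0] assms by (simp add: asymptotic_def)
  then show ?thesis unfolding asymptotic_def
    by (rule tendsto_sandwich[rotated 3, where f = "\<lambda>_. 0"]) (auto simp: dist_triangle)
qed

text \<open>
  The scrambled set picks one point from each asymptotic class of a set whose points are pairwise
  proximal; countably many classes are excluded by a diagonal argument.
\<close>

lemma li_yorke_if_diagonal: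
  assumes proximal: "\<And>x y. x \<in> B \<Longrightarrow> y \<in> B \<Longrightarrow>
      liminf (\<lambda>n. ereal (dist ((F ^^ n) x) ((F ^^ n) y))) = 0"
    and diagonal: "\<And>w :: nat \<Rightarrow> real. range w \<subseteq> B \<Longrightarrow> \<exists>x\<in>B. \<forall>j. \<not> asymptotic F x (w j)"
    and B: "B \<subseteq> X" "B \<noteq> {}"
  shows "li_yorke_chaotic X F"
proof -
  define rep where "rep x = (SOME y. y \<in> B \<and> asymptotic F x y)" for x
  have refl: "asymptotic F x x" for x by (simp add: asymptotic_def)
  have rep: "rep x \<in> B \<and> asymptotic F x (rep x)" if "x \<in> B" for x
    unfolding rep_def by (rule someI[of _ x]) (use that refl in auto)
  define S where "S = rep ` B"
  have S: "S \<subseteq> B" "S \<noteq> {}" using rep B by (auto simp: S_def)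
  have sep: "\<not> asymptotic F s t" if in_S: "s \<in> S" "t \<in> S" and ne: "s \<noteq> t" for s t
  proof
    assume st: "asymptotic F s t"
    obtain x y where xy: "x \<in> B" "y \<in> B" "s = rep x" "t = rep y" using in_S by (auto simp: S_def)
    then have "asymptotic F x y" using rep st asymptotic_sym asymptotic_trans by metis
    \<comment> \<open>Equality of the two predicates makes the choice in \<open>rep\<close> return
      the same point for \<open>x\<close> and \<open>y\<close>.\<close>
    then have "asymptotic F x = asymptotic F y"
      using asymptotic_sym asymptotic_trans by blast
    then show False using ne xy by (simp add: rep_def)
  qed
  have "uncountable S"
  proof
    assume c: "countable S"
    \<comment> \<open>The enumeration may repeat values, so finite \<open>S\<close> is covered as
      well.\<close>
    have r: "range (from_nat_into S) = S" using range_from_nat_into[OF S(2) c] .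
    then obtain x where x: "x \<in> B" "\<And>j. \<not> asymptotic F x (from_nat_into S j)"
      using diagonal[of "from_nat_into S"] S by blast
    have "rep x \<in> S" using x by (simp add: S_def)
    then obtain j where "rep x = from_nat_into S j" using r by (metis rangeE)
    then show False using rep x by metis
  qed
  moreover have "limsup (\<lambda>n. ereal (dist ((F ^^ n) s) ((F ^^ n) t))) > 0"
    if "s \<in> S" "t \<in> S" "s \<noteq> t" for s t
    by (rule limsup_pos_if_not_tendsto) (use sep[OF that] in \<open>simp_all add: asymptotic_def\<close>)
  moreover have "liminf (\<lambda>n. ereal (dist ((F ^^ n) s) ((F ^^ n) t))) = 0"
    if "s \<in> S" "t \<in> S" for s t
    using proximal that S(1) by blast
  moreover have "S \<subseteq> X" using S B by blast
  ultimately show ?thesis unfolding li_yorke_chaotic_def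
    by (intro exI[of _ S] conjI ballI impI) simp_all
qed

text \<open>The mutual coverings at common times realize every itinerary over \<open>{u,v}\<close>
  by shrinking balls. Prescribing \<open>u\<close> at even indices makes all points of
  \<open>B\<close> pairwise proximal; the odd indices remain free to stay away from any given
  sequence of points.\<close>

lemma li_yorke_criterion:
  fixes F :: "real \<Rightarrow> real"
  assumes cont: "continuous_on UNIV F" and range: "range F \<subseteq> X" and uv: "u \<noteq> v"
    and star: "\<And>e. e > 0 \<Longrightarrow> \<exists>n. \<exists>e'>0.
      ball u e' \<union> ball v e' \<subseteq> (F ^^ n) ` ball u e \<inter> (F ^^ n) ` ball v e"
  shows "li_yorke_chaotic X F"
proof -
  \<comment> \<open>Half the distance from \<open>u\<close> to \<open>v\<close> is
    \<open>4 * \<rho>\<close>, so every point is at least that far from one of them. An error of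
    \<open>\<rho>\<close> in hitting the target still leaves a separation of
    \<open>3 * \<rho>\<close>.\<close>
  define \<rho> where "\<rho> = \<bar>u - v\<bar> / 8"
  have \<rho>: "\<rho> > 0" using uv by (simp add: \<rho>_def)
  let ?Q = "\<lambda>e e' n. n \<ge> 1 \<and> (\<forall>c\<in>{u,v}. \<forall>d\<in>{u,v}. cball d e' \<subseteq> (F ^^ n) ` cball c e)"
  have step: "\<exists>e'. (0 < e' \<and> e' \<le> m) \<and> (\<exists>n. ?Q e e' n)" if e: "0 < e" and m: "0 < m" for e m :: real
  proof -
    let ?e = "min e \<rho>"
    obtain n r where r: "r > 0"
      "ball u r \<union> ball v r \<subseteq> (F ^^ n) ` ball u ?e \<inter> (F ^^ n) ` ball v ?e"
      using star[of ?e] e \<rho> by auto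
    \<comment> \<open>Positive time steps are what makes the visiting times strictly
      increasing.\<close>
    have "n \<noteq> 0"
    proof
      assume "n = 0"
      then have "ball v r \<subseteq> ball u ?e" using r(2) by simp
      then have "v \<in> ball u ?e" using r(1) centre_in_ball by blast
      then show False using \<rho> by (simp add: dist_real_def \<rho>_def)
    qed
    define e' where "e' = min m (r / 2)"
    have e': "0 < e'" "e' \<le> m" "e' < r" using r m by (auto simp: e'_def)
    have "cball d e' \<subseteq> (F ^^ n) ` cball c e" if "c \<in> {u,v}" "d \<in> {u,v}" for c d
    proof -
      have "cball d e' \<subseteq> ball d r" using e' by auto
      also have "\<dots> \<subseteq> (F ^^ n) ` ball c ?e" using r that by auto
      also have "\<dots> \<subseteq> (F ^^ n) ` cball c e" by (intro image_mono) auto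
      finally show ?thesis .
    qed
    then have "?Q e e' n" using \<open>n \<noteq> 0\<close> by simp
    then show ?thesis using e' by blast
  qed
  \<comment> \<open>Dependent choice; the parameter \<open>m\<close> of \<open>step\<close> imposes
    the bound that forces the radii to tend to 0.\<close>
  have "\<exists>\<epsilon>. \<forall>k. (0 < \<epsilon> k \<and> \<epsilon> k \<le> \<rho> / real (Suc k)) \<and> (\<exists>n. ?Q (\<epsilon> k) (\<epsilon> (Suc k)) n)"
  proof (rule dependent_nat_choice)
    show "\<exists>x>0. x \<le> \<rho> / real (Suc 0)" using \<rho> by (intro exI[of _ \<rho>]) auto
  qed (use step \<rho> in auto)
  then obtain \<epsilon> where \<epsilon>: "\<And>k. 0 < \<epsilon> k" "\<And>k. \<epsilon> k \<le> \<rho> / real (Suc k)"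
    and "\<forall>k. \<exists>n. ?Q (\<epsilon> k) (\<epsilon> (Suc k)) n"
    by blast
  then obtain n where n: "\<And>k. ?Q (\<epsilon> k) (\<epsilon> (Suc k)) (n k)" by metis
  \<comment> \<open>The point supplied by \<open>compact_chain\<close> may lie outside
    \<open>X\<close>. Its image under \<open>F\<close> does not, and using that image instead lowers
    every visiting time by one.\<close>
  define t where "t k = (\<Sum>i<Suc k. n i) - 1" for k
  have Suc_t: "Suc (t k) = (\<Sum>i<Suc k. n i)" for k
    using n[of k] by (simp add: t_def)
  have t: "strict_mono t"
  proof (rule strict_monoI_Suc)
    fix k show "t k < t (Suc k)" using n[of "Suc k"] Suc_t[of k] Suc_t[of "Suc k"] by simp
  qed
  have \<epsilon>\<rho>: "\<epsilon> (Suc k) \<le> \<rho>" for k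
  proof -
    have "\<rho> / real (Suc (Suc k)) \<le> \<rho>" using \<rho> by (simp add: field_simps)
    then show ?thesis using \<epsilon>(2)[of "Suc k"] by linarith
  qed
  have \<epsilon>0: "(\<lambda>k. 2 * \<epsilon> (Suc (2 * k))) \<longlonglongrightarrow> 0"
  proof (rule tendsto_sandwich[where f = "\<lambda>_. 0" and h = "\<lambda>k. 2 * \<rho> / real (Suc k)"])
    have "2 * \<epsilon> (Suc (2 * k)) \<le> 2 * \<rho> / real (Suc k)" for k
    proof -
      have "\<rho> / real (Suc (Suc (2 * k))) \<le> \<rho> / real (Suc k)"
        using \<rho> by (intro divide_left_mono) auto
      then show ?thesis using \<epsilon>(2)[of "Suc (2 * k)"] by simp
    qed
    then show "\<forall>\<^sub>F k in sequentially. 2 * \<epsilon> (Suc (2 * k)) \<le> 2 * \<rho> / real (Suc k)" by simp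
    show "(\<lambda>k. 2 * \<rho> / real (Suc k)) \<longlonglongrightarrow> 0"
      using tendsto_mult_right_zero[OF LIMSEQ_inverse_real_of_nat, of "2 * \<rho>"]
      by (simp add: divide_inverse)
  qed (use \<epsilon>(1)[THEN less_imp_le] in auto)
  have realize: "\<exists>x\<in>X. \<forall>k. (F ^^ t k) x \<in> cball (d k) (\<epsilon> (Suc k))"
    if d: "\<And>k. d k \<in> {u,v}" for d
  proof -
    \<comment> \<open>Index 0 only fixes the starting ball; the target \<open>d k\<close> is met at
      index \<open>k + 1\<close>.\<close>
    define A where "A k = (case k of 0 \<Rightarrow> cball u (\<epsilon> 0) | Suc j \<Rightarrow> cball (d j) (\<epsilon> (Suc j)))" for k
    have AS: "A (Suc k) = cball (d k) (\<epsilon> (Suc k))" for k by (simp add: A_def)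
    have A_c: "\<exists>c\<in>{u,v}. A k = cball c (\<epsilon> k)" for k
    proof (cases k)
      case (Suc i)
      then show ?thesis using d[of i] by (intro bexI[of _ "d i"]) (simp_all add: A_def)
    qed (simp add: A_def)
    have "\<exists>x. \<forall>k. (F ^^ (\<Sum>i<k. n i)) x \<in> A k"
    proof (rule compact_chain[OF cont])
      show "compact (A k)" for k using A_c[of k] by auto
      show "A 0 \<noteq> {}" using \<epsilon>(1)[of 0] by (simp add: A_def)
      show "A (Suc k) \<noteq> {} \<and> A (Suc k) \<subseteq> (F ^^ n k) ` A k" for k
      proof
        show "A (Suc k) \<noteq> {}" using \<epsilon>(1)[of "Suc k"] by (simp add: AS)
        show "A (Suc k) \<subseteq> (F ^^ n k) ` A k"
          using A_c[of k] n[of k] d[of k] unfolding AS by metis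
      qed
    qed
    then obtain x where x: "\<And>k. (F ^^ (\<Sum>i<k. n i)) x \<in> A k" by blast
    have "(F ^^ t k) (F x) \<in> cball (d k) (\<epsilon> (Suc k))" for k
      using x[of "Suc k"] by (simp only: AS Suc_t[symmetric] funpow_Suc_right o_apply)
    moreover have "F x \<in> X" using range by auto
    ultimately show ?thesis by blast
  qed
  define B where "B = {x \<in> X. \<forall>k. (F ^^ t (2 * k)) x \<in> cball u (\<epsilon> (Suc (2 * k)))}"
  show ?thesis
  proof (rule li_yorke_if_diagonal)
    show "B \<subseteq> X" by (auto simp: B_def)
    show "B \<noteq> {}" using realize[of "\<lambda>_. u"] by (auto simp: B_def)
    fix x y assume xy: "x \<in> B" "y \<in> B"
    show "liminf (\<lambda>n. ereal (dist ((F ^^ n) x) ((F ^^ n) y))) = 0"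
    proof (rule liminf_zero_if_subseq[where r = "\<lambda>k. t (2 * k)"])
      show "strict_mono (\<lambda>k. t (2 * k))" using t by (simp add: strict_mono_def)
      have "dist ((F ^^ t (2 * k)) x) ((F ^^ t (2 * k)) y) \<le> 2 * \<epsilon> (Suc (2 * k))" for k
      proof -
        have "dist u ((F ^^ t (2 * k)) x) \<le> \<epsilon> (Suc (2 * k))"
          "dist u ((F ^^ t (2 * k)) y) \<le> \<epsilon> (Suc (2 * k))"
          using xy by (auto simp: B_def)
        then show ?thesis
          using dist_triangle3[of "(F ^^ t (2 * k)) x" "(F ^^ t (2 * k)) y" u] by linarith
      qed
      then show "(\<lambda>k. dist ((F ^^ t (2 * k)) x) ((F ^^ t (2 * k)) y)) \<longlonglongrightarrow> 0"
        by (intro tendsto_sandwich[OF _ _ tendsto_const \<epsilon>0]) auto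
    qed simp
  next
    fix w :: "nat \<Rightarrow> real"
    \<comment> \<open>Every index \<open>i\<close> equals \<open>j k\<close> for arbitrarily large
      odd \<open>k\<close>, so each \<open>w i\<close> is avoided infinitely often.\<close>
    define j where "j k = fst (prod_decode (k div 2))" for k
    \<comment> \<open>At odd \<open>k\<close> the target is one of \<open>u\<close>,
      \<open>v\<close> at distance at least \<open>4 * \<rho>\<close> from the iterate of
      \<open>w (j k)\<close>.\<close>
    define d where "d k = (if even k \<or> \<bar>(F ^^ t k) (w (j k)) - u\<bar> \<ge> 4 * \<rho> then u else v)" for k
    have "d k \<in> {u,v}" for k by (simp add: d_def)
    then obtain x where x: "x \<in> X" "\<And>k. (F ^^ t k) x \<in> cball (d k) (\<epsilon> (Suc k))"
      using realize[of d] by blast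
    have "(F ^^ t (2 * k)) x \<in> cball u (\<epsilon> (Suc (2 * k)))" for k
      using x(2)[of "2 * k"] by (simp add: d_def)
    then have "x \<in> B" using x(1) by (simp add: B_def)
    moreover have "\<not> asymptotic F x (w i)" for i
    proof
      assume "asymptotic F x (w i)"
      then have "\<forall>\<^sub>F n in sequentially. dist ((F ^^ n) x) ((F ^^ n) (w i)) < \<rho>"
        using \<rho> unfolding asymptotic_def by (rule order_tendstoD(2))
      then obtain N where N: "\<And>n. n \<ge> N \<Longrightarrow> dist ((F ^^ n) x) ((F ^^ n) (w i)) < \<rho>"
        by (auto simp: eventually_sequentially)
      define k where "k = 2 * prod_encode (i, N) + 1"
      have k: "odd k" "j k = i" by (auto simp: k_def j_def)
      have "N \<le> k" using le_prod_encode_2[of N i] by (simp add: k_def)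
      also have "k \<le> t k" using t by (rule strict_mono_imp_increasing)
      finally have near: "dist ((F ^^ t k) x) ((F ^^ t k) (w i)) < \<rho>" by (rule N)
      have "dist (d k) ((F ^^ t k) x) \<le> \<rho>" using x(2)[of k] \<epsilon>\<rho>[of k] by simp
      moreover have "\<bar>(F ^^ t k) (w i) - d k\<bar> \<ge> 4 * \<rho>"
        using k \<rho> by (auto simp: d_def \<rho>_def abs_if field_simps split: if_splits)
      ultimately show False using near \<rho> by (simp add: dist_real_def abs_if split: if_splits)
    qed
    ultimately show "\<exists>x\<in>B. \<forall>i. \<not> asymptotic F x (w i)" by blast
  qed
qed

section \<open>Cycles of intervals generated by small balls\<close>

text \<open>Transitivity on \<open>Y\<close>, phrased with sets open in the line. Sensitivity enters
  here only through its consequence that \<open>Y\<close> has no isolated points.\<close>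

locale transitive_perfect =
  fixes F :: "real \<Rightarrow> real" and Y :: "real set"
  assumes cont: "continuous_on UNIV F"
    and invariant: "F ` Y \<subseteq> Y"
    and transitive: "\<And>U V. open U \<Longrightarrow> open V \<Longrightarrow> U \<inter> Y \<noteq> {} \<Longrightarrow> V \<inter> Y \<noteq> {} \<Longrightarrow>
      \<exists>n. \<exists>y\<in>U \<inter> Y. (F ^^ n) y \<in> V"
    and perfect: "\<And>U y. open U \<Longrightarrow> y \<in> U \<inter> Y \<Longrightarrow> \<exists>y'\<in>U \<inter> Y. y' \<noteq> y"
begin

lemma iterate_in: "y \<in> Y \<Longrightarrow> (F ^^ n) y \<in> Y"
  using invariant by (induction n) auto

lemma cont_iterate: "continuous_on S (F ^^ n)"
  using continuous_funpow[OF cont] continuous_on_subset by blast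

lemma open_preimage: "open V \<Longrightarrow> open ((F ^^ n) -` V)"
  using cont_iterate[of UNIV] by (simp add: continuous_on_open_vimage)

lemma connected_iterate: "connected S \<Longrightarrow> connected ((F ^^ n) ` S)"
  using cont_iterate connected_continuous_image by blast

section \<open>Splitting open sets and recurrence\<close>

lemma split_open:
  assumes "open U" "U \<inter> Y \<noteq> {}"
  shows "\<exists>V W. open V \<and> open W \<and> V \<subseteq> U \<and> W \<subseteq> U \<and> V \<inter> Y \<noteq> {} \<and> W \<inter> Y \<noteq> {} \<and>
    (\<forall>s\<in>V. \<forall>t\<in>W. s < t)"
proof -
  obtain y y' where "y \<in> U \<inter> Y" "y' \<in> U \<inter> Y" "y' \<noteq> y" using assms perfect by blast
  then obtain s t where st: "s \<in> U \<inter> Y" "t \<in> U \<inter> Y" "s < t" by (metis linorder_neq_iff)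
  let ?m = "(s + t) / 2"
  have m: "s < ?m" "?m < t" using st by auto
  show ?thesis
    by (rule exI[of _ "U \<inter> {..<?m}"], rule exI[of _ "U \<inter> {?m<..}"])
      (use assms st m in auto)
qed

lemma split_open4:
  assumes "open U" "U \<inter> Y \<noteq> {}"
  obtains V1 V2 V3 V4 where "open V1" "open V2" "open V3" "open V4"
    "V1 \<subseteq> U" "V2 \<subseteq> U" "V3 \<subseteq> U" "V4 \<subseteq> U"
    "V1 \<inter> Y \<noteq> {}" "V2 \<inter> Y \<noteq> {}" "V3 \<inter> Y \<noteq> {}" "V4 \<inter> Y \<noteq> {}"
    "\<forall>s\<in>V1. \<forall>t\<in>V2. s < t" "\<forall>s\<in>V2. \<forall>t\<in>V3. s < t" "\<forall>s\<in>V3. \<forall>t\<in>V4. s < t"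
proof -
  obtain V W where VW: "open V" "open W" "V \<subseteq> U" "W \<subseteq> U" "V \<inter> Y \<noteq> {}" "W \<inter> Y \<noteq> {}"
    "\<forall>s\<in>V. \<forall>t\<in>W. s < t"
    using split_open[OF assms] by metis
  obtain V1 V2 where V: "open V1" "open V2" "V1 \<subseteq> V" "V2 \<subseteq> V" "V1 \<inter> Y \<noteq> {}" "V2 \<inter> Y \<noteq> {}"
    "\<forall>s\<in>V1. \<forall>t\<in>V2. s < t"
    using split_open[OF VW(1,5)] by metis
  obtain V3 V4 where W: "open V3" "open V4" "V3 \<subseteq> W" "V4 \<subseteq> W" "V3 \<inter> Y \<noteq> {}" "V4 \<inter> Y \<noteq> {}"
    "\<forall>s\<in>V3. \<forall>t\<in>V4. s < t"
    using split_open[OF VW(2,6)] by metis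
  have "V1 \<subseteq> U" "V2 \<subseteq> U" "V3 \<subseteq> U" "V4 \<subseteq> U" using VW V W by blast+
  have "\<forall>s\<in>V2. \<forall>t\<in>V3. s < t" using VW(7) V(4) W(3) by blast
  show ?thesis by (rule that[of V1 V2 V3 V4]) fact+
qed

text \<open>Transitivity from \<open>U\<close> to itself could be witnessed by time 0. Travelling
  between two disjoint parts of \<open>U\<close> takes positive time.\<close>

lemma recurrent:
  assumes "open U" "U \<inter> Y \<noteq> {}"
  shows "\<exists>n\<ge>1. \<exists>y\<in>U \<inter> Y. (F ^^ n) y \<in> U"
proof -
  obtain V W where VW: "open V" "open W" "V \<subseteq> U" "W \<subseteq> U" "V \<inter> Y \<noteq> {}" "W \<inter> Y \<noteq> {}"
    "\<forall>s\<in>V. \<forall>t\<in>W. s < t"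
    using split_open[OF assms] by metis
  then obtain n y where n: "y \<in> V \<inter> Y" "(F ^^ n) y \<in> W"
    using transitive[of V W] by blast
  have "n \<noteq> 0" using n VW(7) by (cases n) auto
  then show ?thesis using n VW by (intro exI[of _ n]) auto
qed

text \<open>A visit to \<open>V\<close> at time \<open>n\<close> is postponed by recurrence: a point
  of \<open>?W\<close> that returns to \<open>?W\<close> after \<open>m\<close> steps is in
  \<open>V\<close> at time \<open>n + m\<close>.\<close>

lemma transitive_ge:
  assumes "open U" "open V" "U \<inter> Y \<noteq> {}" "V \<inter> Y \<noteq> {}"
  shows "\<exists>n\<ge>N. \<exists>y\<in>U \<inter> Y. (F ^^ n) y \<in> V"
proof (induction N)
  case 0
  then show ?case using transitive[OF assms] by auto
next
  case (Suc N)
  then obtain n y where n: "n \<ge> N" "y \<in> U \<inter> Y" "(F ^^ n) y \<in> V" by blast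
  let ?W = "U \<inter> (F ^^ n) -` V"
  have "open ?W" using assms open_preimage by blast
  moreover have "?W \<inter> Y \<noteq> {}" using n by blast
  ultimately obtain m w where m: "m \<ge> 1" "w \<in> ?W \<inter> Y" "(F ^^ m) w \<in> ?W"
    using recurrent by blast
  have "(F ^^ (n + m)) w \<in> V" using m(3) by (simp add: funpow_add)
  then show ?case using m n by (intro exI[of _ "n + m"] conjI bexI[of _ w]) auto
qed

text \<open>
  \<open>piece x e\<close> is one of \<open>per x e\<close> disjoint intervals that \<open>F\<close> maps cyclically into one another.
\<close>

definition orb :: "real \<Rightarrow> real \<Rightarrow> real set" where
  "orb x e = (\<Union>i. (F ^^ i) ` ball x e)"

definition piece :: "real \<Rightarrow> real \<Rightarrow> real set" where
  "piece x e = connected_component_set (orb x e) x"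

definition per :: "real \<Rightarrow> real \<Rightarrow> nat" where
  "per x e = (LEAST p. p \<ge> 1 \<and> (F ^^ p) ` piece x e \<inter> piece x e \<noteq> {})"

section \<open>Invariance and periods of pieces\<close>

lemma iterate_orb: "(F ^^ n) ` orb x e \<subseteq> orb x e"
proof
  fix t assume "t \<in> (F ^^ n) ` orb x e"
  then obtain i s where "s \<in> ball x e" "t = (F ^^ n) ((F ^^ i) s)" by (auto simp: orb_def)
  then have "t \<in> (F ^^ (n + i)) ` ball x e" by (simp add: funpow_add)
  then show "t \<in> orb x e" unfolding orb_def by blast
qed

lemma piece_subset_orb: "piece x e \<subseteq> orb x e"
  by (simp add: piece_def connected_component_subset)

lemma connected_piece: "connected (piece x e)"
  by (simp add: piece_def)

lemma piece_absorb:
  assumes "connected T" "T \<subseteq> orb x e" "T \<inter> piece x e \<noteq> {}"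
  shows "T \<subseteq> piece x e"
proof -
  obtain t where t: "t \<in> T" "t \<in> piece x e" using assms by blast
  then have "connected_component_set (orb x e) t = piece x e"
    unfolding piece_def by (metis connected_component_eq)
  then show ?thesis using connected_component_maximal[OF t(1) assms(1,2)] by simp
qed

lemma ball_piece:
  assumes "e > 0"
  shows "ball x e \<subseteq> piece x e"
proof -
  have "ball x e \<subseteq> orb x e" 
    using UN_upper[of 0 UNIV "\<lambda>i. (F ^^ i) ` ball x e"] by (simp add: orb_def)
  moreover have "x \<in> ball x e" using assms by simp
  ultimately show ?thesis unfolding piece_def
    by (intro connected_component_maximal) (auto simp: connected_ball)
qed

lemma center_piece: "e > 0 \<Longrightarrow> x \<in> piece x e"
  using ball_piece[of e x] by auto

lemma iterate_piece_absorb: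
  assumes "(F ^^ n) ` piece x e \<inter> piece x e \<noteq> {}"
  shows "(F ^^ n) ` piece x e \<subseteq> piece x e"
proof (rule piece_absorb)
  show "(F ^^ n) ` piece x e \<subseteq> orb x e"
    using iterate_orb[of n x e] piece_subset_orb[of x e] by blast
qed (use assms connected_iterate connected_piece in auto)

text \<open>Justifies the \<open>LEAST\<close> in \<open>per\<close>: by recurrence the generating
  ball, which lies in the piece, returns to itself.\<close>

lemma per_exists:
  assumes "x \<in> Y" "e > 0"
  shows "per x e \<ge> 1 \<and> (F ^^ per x e) ` piece x e \<inter> piece x e \<noteq> {}"
proof -
  have "ball x e \<inter> Y \<noteq> {}" using assms centre_in_ball by blast
  then obtain n y where "n \<ge> 1" "y \<in> ball x e" "(F ^^ n) y \<in> ball x e"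
    using recurrent[of "ball x e"] by blast
  then have "n \<ge> 1 \<and> (F ^^ n) ` piece x e \<inter> piece x e \<noteq> {}"
    using ball_piece[OF assms(2), of x] by blast
  then show ?thesis unfolding per_def by (rule LeastI)
qed

lemma per_pos: "x \<in> Y \<Longrightarrow> e > 0 \<Longrightarrow> per x e \<ge> 1"
  using per_exists by blast

lemma iterate_piece:
  assumes "x \<in> Y" "e > 0" "per x e dvd n"
  shows "(F ^^ n) ` piece x e \<subseteq> piece x e"
proof -
  obtain k where k: "n = per x e * k" using assms by blast
  have s: "(F ^^ per x e) ` piece x e \<subseteq> piece x e"
    using iterate_piece_absorb per_exists assms by blast
  have "((F ^^ per x e) ^^ k) ` piece x e \<subseteq> piece x e"
    by (induction k) (use s in auto)
  then show ?thesis by (simp add: k funpow_mult)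
qed

text \<open>Division with remainder: multiples of the period keep the piece inside itself, so a
  return at time \<open>n\<close> gives one at the remainder, which must be 0 by minimality.\<close>

lemma per_dvd_iff:
  assumes "x \<in> Y" "e > 0"
  shows "(F ^^ n) ` piece x e \<inter> piece x e \<noteq> {} \<longleftrightarrow> per x e dvd n"
proof
  assume "per x e dvd n"
  then show "(F ^^ n) ` piece x e \<inter> piece x e \<noteq> {}"
    using iterate_piece[OF assms] center_piece[OF assms(2), of x] by blast
next
  let ?p = "per x e" and ?D = "piece x e"
  assume n: "(F ^^ n) ` ?D \<inter> ?D \<noteq> {}"
  define r where "r = n mod ?p"
  have "n = r + ?p * (n div ?p)" by (simp add: r_def)
  then have "(F ^^ n) ` ?D = (F ^^ r) ` (F ^^ (?p * (n div ?p))) ` ?D"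
    using funpow_image_add by metis
  also have "\<dots> \<subseteq> (F ^^ r) ` ?D"
    by (intro image_mono iterate_piece assms) simp
  finally have "(F ^^ r) ` ?D \<inter> ?D \<noteq> {}" using n by blast
  moreover have "r < ?p" using per_pos[OF assms] by (simp add: r_def)
  ultimately have "\<not> r \<ge> 1" unfolding per_def using not_less_Least by blast
  then show "?p dvd n" by (simp add: r_def dvd_eq_mod_eq_0)
qed

lemma per_dvdI:
  assumes "x \<in> Y" "e > 0" "t \<in> piece x e" "(F ^^ n) t \<in> piece x e"
  shows "per x e dvd n"
  using per_dvd_iff[OF assms(1,2)] assms(3,4) by blast

text \<open>A common point of the two iterates is pushed forward until it is back in the piece,
  which shows that \<open>t - s\<close> is a multiple of the period. The later iterate is then the
  \<open>s\<close>-th image of a part of the piece.\<close>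

lemma iterates_piece_nested:
  assumes "x \<in> Y" "e > 0" "s \<le> t" "(F ^^ s) ` piece x e \<inter> (F ^^ t) ` piece x e \<noteq> {}"
  shows "per x e dvd t - s" "(F ^^ t) ` piece x e \<subseteq> (F ^^ s) ` piece x e"
proof -
  let ?p = "per x e" and ?D = "piece x e"
  \<comment> \<open>Completes \<open>s\<close> to the multiple \<open>?p * s\<close> of the
    period.\<close>
  define j where "j = s * (?p - 1)"
  have sj: "j + s = ?p * s" using per_pos[OF assms(1,2)]
    by (cases ?p) (auto simp: j_def algebra_simps)
  obtain a b where ab: "a \<in> ?D" "b \<in> ?D" "(F ^^ s) a = (F ^^ t) b" using assms(4) by blast
  have "(F ^^ (j + s)) a = (F ^^ (j + t)) b" using ab(3) by (simp add: funpow_add)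
  moreover have "(F ^^ (j + s)) a \<in> ?D"
    using iterate_piece[OF assms(1,2), of "j + s"] ab(1) sj by auto
  ultimately have "?p dvd j + t" using per_dvdI[OF assms(1,2) ab(2)] by metis
  moreover have "j + t = ?p * s + (t - s)" using sj assms(3) by linarith
  ultimately show d: "?p dvd t - s" by (metis dvd_add_right_iff dvd_triv_left)
  have "(F ^^ t) ` ?D = (F ^^ s) ` (F ^^ (t - s)) ` ?D"
    using funpow_image_add[of s "t - s" F ?D] assms(3) by simp
  then show "(F ^^ t) ` ?D \<subseteq> (F ^^ s) ` ?D"
    using iterate_piece[OF assms(1,2) d] by blast
qed

lemma iterate_piece_overlap:
  assumes "x \<in> Y" "e > 0" "(F ^^ k) ` (F ^^ s) ` piece x e \<inter> (F ^^ s) ` piece x e \<noteq> {}"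
  shows "per x e dvd k"
  using iterates_piece_nested(1)[OF assms(1,2), of s "k + s"] assms(3)
  by (simp add: funpow_image_add Int_commute)

text \<open>\<open>F ^^ N\<close> commutes with the iterates that generate the orbit, so it maps
  \<open>piece x' e'\<close> to a connected subset of \<open>orb x e\<close> that meets the piece at
  the image of \<open>x'\<close>.\<close>

lemma piece_mono:
  assumes "e' > 0" "(F ^^ N) ` ball x' e' \<subseteq> piece x e"
  shows "(F ^^ N) ` piece x' e' \<subseteq> piece x e"
proof (rule piece_absorb)
  show "connected ((F ^^ N) ` piece x' e')" by (intro connected_iterate connected_piece)
  show "(F ^^ N) ` piece x' e' \<subseteq> orb x e"
  proof
    fix t assume "t \<in> (F ^^ N) ` piece x' e'"
    then obtain i s where s: "s \<in> ball x' e'" "t = (F ^^ N) ((F ^^ i) s)"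
      using piece_subset_orb[of x' e'] by (auto simp: orb_def)
    then have "t = (F ^^ i) ((F ^^ N) s)"
      by (metis add.commute funpow_add_apply)
    then show "t \<in> orb x e"
      using s assms(2) piece_subset_orb[of x e] iterate_orb[of i x e] by blast
  qed
  have "(F ^^ N) x' \<in> (F ^^ N) ` piece x' e' \<inter> piece x e"
    using center_piece[OF assms(1), of x'] assms by auto
  then show "(F ^^ N) ` piece x' e' \<inter> piece x e \<noteq> {}" by blast
qed

text \<open>The return of \<open>x'\<close> to its own piece is carried by \<open>F ^^ N\<close> to
  a return within \<open>piece x e\<close>. With \<open>N = 0\<close> this compares a ball with a
  smaller one.\<close>

lemma per_dvd_per:
  assumes "x \<in> Y" "e > 0" "x' \<in> Y" "e' > 0" "(F ^^ N) ` ball x' e' \<subseteq> piece x e"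
  shows "per x e dvd per x' e'"
proof (rule per_dvdI[OF assms(1,2)])
  let ?p = "per x' e'"
  note N = piece_mono[OF assms(4,5)]
  have x': "x' \<in> piece x' e'" using center_piece assms by blast
  then show "(F ^^ N) x' \<in> piece x e" using N by blast
  have "(F ^^ ?p) x' \<in> piece x' e'" using iterate_piece[OF assms(3,4), of ?p] x' by auto
  then have "(F ^^ N) ((F ^^ ?p) x') \<in> piece x e" using N by blast
  then show "(F ^^ ?p) ((F ^^ N) x') \<in> piece x e" by (metis add.commute funpow_add_apply)
qed

lemma piece_covered:
  assumes "x \<in> Y" "e > 0" "t \<in> piece x e"
  shows "\<exists>n. per x e dvd n \<and> t \<in> (F ^^ n) ` ball x e"
proof -
  obtain n s where s: "s \<in> ball x e" "t = (F ^^ n) s"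
    using assms piece_subset_orb[of x e] by (auto simp: orb_def)
  then show ?thesis
    using per_dvdI[OF assms(1,2)] ball_piece[OF assms(2), of x] assms(3) by blast
qed

text \<open>Once an iterate of the ball at a multiple of the period contains \<open>z\<close>, all
  later ones at such times do, since \<open>z\<close> stays fixed.\<close>

lemma fixed_covered:
  assumes "x \<in> Y" "e > 0" "z \<in> piece x e" "(F ^^ per x e) z = z"
  shows "\<exists>n0. \<forall>n\<ge>n0. per x e dvd n \<longrightarrow> z \<in> (F ^^ n) ` ball x e"
proof -
  obtain m where m: "per x e dvd m" "z \<in> (F ^^ m) ` ball x e"
    using piece_covered[OF assms(1-3)] by blast
  have "z \<in> (F ^^ n) ` ball x e" if "n \<ge> m" "per x e dvd n" for n
  proof -
    have "(F ^^ (n - m)) z = z" by (rule funpow_fixed[OF assms(4)]) (use that m in simp)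
    moreover have "(F ^^ n) ` ball x e = (F ^^ (n - m)) ` (F ^^ m) ` ball x e"
      using that(1) by (simp flip: funpow_image_add)
    ultimately show ?thesis using m(2) by (metis imageI)
  qed
  then show ?thesis by blast
qed

text \<open>
  A point that is moved up by \<open>F ^^ per x e\<close> and recurs must be moved down somewhere
  along its orbit, so the intermediate value theorem applies between two points of its orbit.
\<close>

lemma fixed_point_in_piece:
  assumes "x \<in> Y" "e > 0"
  shows "\<exists>z y j j'. (F ^^ per x e) z = z \<and> y \<in> Y \<inter> ball x e \<and> per x e dvd j \<and> per x e dvd j' \<and>
    (F ^^ j) y < z \<and> z < (F ^^ j') y"
proof -
  define p where "p = per x e"
  define g where "g = F ^^ p"
  have g: "continuous_on UNIV g" by (simp add: g_def cont_iterate)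
  have gk: "(g ^^ k) t = (F ^^ (p * k)) t" for k t by (simp add: g_def funpow_mult)
  have dvd: "p dvd n" if "t \<in> ball x e" "(F ^^ n) t \<in> ball x e" for n t
    unfolding p_def by (rule per_dvdI[OF assms]) (use that ball_piece[OF assms(2), of x] in auto)
  \<comment> \<open>If \<open>g\<close> fixed every point of \<open>Y\<close> in the ball, a point
    moving from \<open>V\<close> to \<open>W\<close> would do so at a multiple of \<open>p\<close>
    and hence not move at all.\<close>
  have "\<exists>s\<in>Y \<inter> ball x e. g s \<noteq> s"
  proof (rule ccontr)
    assume *: "\<not> ?thesis"
    have "ball x e \<inter> Y \<noteq> {}" using assms centre_in_ball by blast
    then obtain V W where VW: "open V" "open W" "V \<subseteq> ball x e" "W \<subseteq> ball x e"
      "V \<inter> Y \<noteq> {}" "W \<inter> Y \<noteq> {}" "\<forall>s\<in>V. \<forall>t\<in>W. s < t"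
      using split_open[of "ball x e"] by auto
    then obtain n y where n: "y \<in> V \<inter> Y" "(F ^^ n) y \<in> W" using transitive[of V W] by blast
    then have "p dvd n" using dvd VW by blast
    moreover have "(F ^^ p) y = y" using * n VW by (auto simp: g_def)
    ultimately have "(F ^^ n) y = y" using funpow_fixed by metis
    then show False using n VW by force
  qed
  then obtain s where s: "s \<in> Y" "s \<in> ball x e" "g s \<noteq> s" by blast
  \<comment> \<open>With a third of the displacement as tolerance, \<open>g y\<close> lies on the
    same side of both \<open>y\<close> and its later return \<open>(g ^^ k) y\<close>.\<close>
  define r where "r = \<bar>g s - s\<bar> / 3"
  have r: "r > 0" using s by (simp add: r_def)
  define W where "W = ball x e \<inter> ball s r \<inter> g -` ball (g s) r"
  have "open W" unfolding W_def g_def by (intro open_Int open_ball open_preimage)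
  moreover have "W \<inter> Y \<noteq> {}" using s r by (auto simp: W_def)
  ultimately obtain n y where n: "n \<ge> 1" "y \<in> W" "y \<in> Y" "(F ^^ n) y \<in> W"
    using recurrent by blast
  then have "p dvd n" using dvd[of y n] by (simp add: W_def)
  then obtain k where k: "n = p * k" by blast
  then have k1: "k \<ge> 1" using n(1) by (cases k) auto
  have yk: "(g ^^ k) y \<in> W" using n k gk by simp
  have near: "\<bar>y - s\<bar> < r" "\<bar>g y - g s\<bar> < r" "\<bar>(g ^^ k) y - s\<bar> < r"
    using n(2) yk by (auto simp: W_def dist_real_def abs_minus_commute)
  have "\<exists>z j j'. g z = z \<and> (g ^^ j) y < z \<and> z < (g ^^ j') y"
  proof (cases "g s > s")
    case True
    then have gs: "g s = s + 3 * r" by (simp add: r_def field_simps)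
    have "g y > y" "(g ^^ 1) y > (g ^^ k) y" using near gs by (simp_all add: abs_less_iff)
    moreover obtain j where "(g ^^ Suc j) y < (g ^^ j) y"
      using descent_step[OF calculation(2) k1] by blast
    ultimately obtain z where z: "g z = z" and
      "y < z \<and> z < (g ^^ j) y \<or> (g ^^ j) y < z \<and> z < y"
      using fixed_point_between[OF g, of y "(g ^^ j) y"] by auto
    then have "(g ^^ 0) y < z \<and> z < (g ^^ j) y \<or> (g ^^ j) y < z \<and> z < (g ^^ 0) y" by simp
    with z show ?thesis by blast
  next
    case False
    then have gs: "g s = s - 3 * r" using s(3) by (simp add: r_def field_simps abs_if)
    have "g y < y" "(g ^^ 1) y < (g ^^ k) y" using near gs by (simp_all add: abs_less_iff)
    moreover obtain j where "(g ^^ Suc j) y > (g ^^ j) y"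
      using ascent_step[OF calculation(2) k1] by blast
    ultimately obtain z where z: "g z = z" and
      "(g ^^ j) y < z \<and> z < y \<or> y < z \<and> z < (g ^^ j) y"
      using fixed_point_between[OF g, of "(g ^^ j) y" y] by auto
    then have "(g ^^ 0) y < z \<and> z < (g ^^ j) y \<or> (g ^^ j) y < z \<and> z < (g ^^ 0) y" by auto
    with z show ?thesis by blast
  qed
  then obtain z j j' where z: "g z = z" "(g ^^ j) y < z" "z < (g ^^ j') y" by blast
  show ?thesis
    by (rule exI[of _ z], rule exI[of _ y], rule exI[of _ "p * j"], rule exI[of _ "p * j'"])
      (use z n(2,3) gk in \<open>auto simp: g_def W_def p_def\<close>)
qed

lemma between_in_piece:
  assumes "x \<in> Y" "e > 0" "y \<in> piece x e" "per x e dvd j" "per x e dvd j'"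
    "(F ^^ j) y < z" "z < (F ^^ j') y"
  shows "z \<in> piece x e"
proof (rule connected_real_between[OF connected_piece])
  show "(F ^^ j) y \<in> piece x e" "(F ^^ j') y \<in> piece x e"
    using iterate_piece[OF assms(1,2)] assms(3-5) by blast+
qed (use assms(6,7) in simp_all)

end

section \<open>Bounded periods\<close>

text \<open>The covering hypothesis of \<open>li_yorke_criterion\<close>. One time \<open>n\<close>
  serves both balls, so the next target can be chosen freely whichever ball is current.\<close>

definition straddled_pair :: "(real \<Rightarrow> real) \<Rightarrow> real \<Rightarrow> real \<Rightarrow> bool" where
  "straddled_pair F u v \<longleftrightarrow> u \<noteq> v \<and> (\<forall>e>0. \<exists>n. \<exists>e'>0.
     ball u e' \<union> ball v e' \<subseteq> (F ^^ n) ` ball u e \<inter> (F ^^ n) ` ball v e)"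

text \<open>\<open>U\<close> covers itself, so its covering times are closed under multiples. Two
  sets with times \<open>m1\<close> and \<open>m2\<close> thus share the time
  \<open>m1 * m2\<close>.\<close>

lemma iterate_cover:
  assumes "U \<union> V \<subseteq> (F ^^ m) ` U" "k \<ge> 1"
  shows "U \<union> V \<subseteq> (F ^^ (m * k)) ` U"
  using assms(2)
proof (induction k rule: dec_induct)
  case base
  then show ?case using assms by simp
next
  case (step k)
  have "U \<union> V \<subseteq> (F ^^ m) ` U" by (rule assms)
  also have "\<dots> \<subseteq> (F ^^ m) ` (F ^^ (m * k)) ` U" using step by (intro image_mono) auto
  also have "\<dots> = (F ^^ (m * Suc k)) ` U" by (simp flip: funpow_image_add)
  finally show ?case .
qed

context transitive_perfect
begin

text \<open>Start from a piece of maximal period \<open>p\<close>. Balls inside \<open>Q\<close>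
  about points of \<open>Y\<close> generate pieces of the same period, so the fixed point
  \<open>z\<close> of \<open>F ^^ p\<close> lies in all these pieces and in the late iterates of the
  balls at multiples of \<open>p\<close>. An iterate that also reaches \<open>W\<close> spans
  \<open>V2\<close> and \<open>V3\<close>.\<close>

lemma straddled_pair_if_per_bounded:
  assumes "Y \<noteq> {}" and bound: "\<And>x e. x \<in> Y \<Longrightarrow> e > 0 \<Longrightarrow> per x e \<le> M"
  shows "\<exists>u v. straddled_pair F u v"
proof -
  obtain x0 where "x0 \<in> Y" using assms by blast
  then have "\<exists>xe. (case xe of (x, e) \<Rightarrow> x \<in> Y \<and> e > 0) \<and>
      (\<forall>xe'. (case xe' of (x, e) \<Rightarrow> x \<in> Y \<and> e > 0) \<longrightarrow> case_prod per xe' \<le> case_prod per xe)"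
    by (intro ex_has_greatest_nat[of _ "(x0, 1)" _ "Suc M"]) (use \<open>x0 \<in> Y\<close> bound in \<open>auto simp: less_Suc_eq_le\<close>)
  then obtain x e where x: "x \<in> Y" "e > 0"
    and max: "\<And>x' e'. x' \<in> Y \<Longrightarrow> e' > 0 \<Longrightarrow> per x' e' \<le> per x e"
    by (auto split: prod.splits)
  define p where "p = per x e"
  obtain z y j j' where z: "(F ^^ p) z = z" and y: "y \<in> Y" "y \<in> ball x e"
    and jj: "p dvd j" "p dvd j'" "(F ^^ j) y < z" "z < (F ^^ j') y"
    using fixed_point_in_piece[OF x] unfolding p_def by blast
  have "y \<noteq> z" using funpow_fixed[OF z jj(1)] jj(3) by auto
  \<comment> \<open>Keeps \<open>Q\<close> on the side of \<open>z\<close> where \<open>y\<close>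
    lies.\<close>
  define A where "A = (if y < z then {..<z} else {z<..})"
  have A: "open A" "y \<in> A" using \<open>y \<noteq> z\<close> by (auto simp: A_def)
  define Q where "Q = ball x e \<inter> (F ^^ j) -` {..<z} \<inter> (F ^^ j') -` {z<..} \<inter> A"
  have "open Q" unfolding Q_def by (intro open_Int open_ball open_preimage A(1)) auto
  moreover have "Q \<inter> Y \<noteq> {}" using y jj A by (auto simp: Q_def)
  ultimately obtain V1 V2 V3 V4 where V:
    "open V1" "open V2" "open V3" "open V4"
    "V1 \<subseteq> Q" "V2 \<subseteq> Q" "V3 \<subseteq> Q" "V4 \<subseteq> Q"
    "V1 \<inter> Y \<noteq> {}" "V2 \<inter> Y \<noteq> {}" "V3 \<inter> Y \<noteq> {}" "V4 \<inter> Y \<noteq> {}"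
    and less: "\<forall>s\<in>V1. \<forall>t\<in>V2. s < t" "\<forall>s\<in>V2. \<forall>t\<in>V3. s < t" "\<forall>s\<in>V3. \<forall>t\<in>V4. s < t"
    by (rule split_open4)
  obtain u v where uv: "u \<in> V2" "u \<in> Y" "v \<in> V3" "v \<in> Y" using V by blast
  \<comment> \<open>The part of \<open>Q\<close> farthest from \<open>z\<close>, so that
    \<open>V2\<close> and \<open>V3\<close> lie between \<open>W\<close> and
    \<open>z\<close>.\<close>
  define W where "W = (if y < z then V1 else V4)"
  have W: "open W" "W \<inter> Y \<noteq> {}" "W \<subseteq> Q" using V by (auto simp: W_def)
  have Qx: "Q \<subseteq> piece x e" using ball_piece[OF x(2), of x] by (auto simp: Q_def)
  have cover: "\<exists>m\<ge>1. V2 \<union> V3 \<subseteq> (F ^^ m) ` ball c r"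
    if c: "c \<in> Y" "r > 0" "ball c r \<subseteq> Q" for c r
  proof -
    have "p dvd per c r"
      unfolding p_def by (rule per_dvd_per[OF x c(1,2), of 0]) (use c Qx in simp)
    moreover have "per c r \<le> p" "per c r \<ge> 1" using max per_pos c by (auto simp: p_def)
    ultimately have per: "per c r = p" using dvd_imp_le by fastforce
    have "c \<in> Q" using c centre_in_ball by blast
    then have "z \<in> piece c r"
      using jj per by (intro between_in_piece[OF c(1,2) center_piece[OF c(2)], of j j'])
        (auto simp: Q_def)
    then obtain n0 where n0: "\<And>n. n \<ge> n0 \<Longrightarrow> p dvd n \<Longrightarrow> z \<in> (F ^^ n) ` ball c r"
      using fixed_covered[OF c(1,2)] z per by metis
    have "ball c r \<inter> Y \<noteq> {}" using c centre_in_ball by blast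
    then obtain m y' where m: "m \<ge> max n0 1" "y' \<in> ball c r" "(F ^^ m) y' \<in> W"
      using transitive_ge[OF open_ball W(1) _ W(2), of c r "max n0 1"] by blast
    have "p dvd m"
      unfolding p_def by (rule per_dvdI[OF x, of y']) (use m c W Qx in blast)+
    then have zm: "z \<in> (F ^^ m) ` ball c r" using n0 m by simp
    have conn: "connected ((F ^^ m) ` ball c r)" by (intro connected_iterate connected_ball)
    have "t \<in> (F ^^ m) ` ball c r" if t: "t \<in> V2 \<union> V3" for t
    proof (cases "y < z")
      case True
      then have "(F ^^ m) y' < t" using less t m uv(1) by (force simp: W_def)
      moreover have "t < z" using t V True by (auto simp: Q_def A_def)
      ultimately show ?thesis
        using connected_real_between[OF conn imageI[OF m(2)] zm] by simp
    next
      case False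
      then have "t < (F ^^ m) y'" using less t m uv(3) by (force simp: W_def)
      moreover have "z < t" using t V False by (auto simp: Q_def A_def)
      ultimately show ?thesis
        using connected_real_between[OF conn zm imageI[OF m(2)]] by simp
    qed
    then show ?thesis using m(1) by (intro exI[of _ m]) auto
  qed
  obtain r1 r2 where r: "r1 > 0" "ball u r1 \<subseteq> V2" "r2 > 0" "ball v r2 \<subseteq> V3"
    using uv V by (meson openE)
  have "\<exists>n. \<exists>e'>0. ball u e' \<union> ball v e' \<subseteq> (F ^^ n) ` ball u d \<inter> (F ^^ n) ` ball v d"
    if "d > 0" for d
  proof -
    define d' where "d' = Min {d, r1, r2}"
    have d': "d' > 0" "d' \<le> d" "d' \<le> r1" "d' \<le> r2" using that r by (auto simp: d'_def)
    have "ball u d' \<subseteq> ball u r1" "ball v d' \<subseteq> ball v r2" using d' by auto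
    then have sub: "ball u d' \<subseteq> V2" "ball v d' \<subseteq> V3" using r by blast+
    then have "ball u d' \<subseteq> Q" "ball v d' \<subseteq> Q" using V by blast+
    then obtain m1 m2 where m: "m1 \<ge> 1" "V2 \<union> V3 \<subseteq> (F ^^ m1) ` ball u d'"
      "m2 \<ge> 1" "V2 \<union> V3 \<subseteq> (F ^^ m2) ` ball v d'"
      using cover[OF uv(2) d'(1)] cover[OF uv(4) d'(1)] by blast
    have "ball u d' \<union> ball v d' \<subseteq> (F ^^ (m1 * m2)) ` ball u d'"
      by (rule iterate_cover) (use m sub in blast)+
    moreover have "ball v d' \<union> ball u d' \<subseteq> (F ^^ (m2 * m1)) ` ball v d'"
      by (rule iterate_cover) (use m sub in blast)+
    moreover have "(F ^^ k) ` ball c d' \<subseteq> (F ^^ k) ` ball c d" for c k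
      using d' by (intro image_mono) auto
    ultimately show ?thesis using d'(1)
      by (intro exI[of _ "m1 * m2"] exI[of _ d']) (simp add: mult.commute, blast)
  qed
  moreover have "u \<noteq> v" using uv less by auto
  ultimately show ?thesis unfolding straddled_pair_def by blast
qed

end

section \<open>Unbounded periods\<close>

text \<open>
  By \<open>deep\<close>, arbitrarily long cycles of intervals fail to separate \<open>u\<close> from \<open>v\<close>.
\<close>

locale inseparable_gap = transitive_perfect +
  fixes u v :: real
  assumes uv: "u < v" "u \<in> Y" "v \<in> Y"
    and gap: "{u<..<v} \<inter> Y = {}"
    and deep: "\<And>M. \<exists>x\<in>Y. \<exists>e>0. \<exists>n. per x e > M \<and>
      u \<in> (F ^^ n) ` piece x e \<and> v \<in> (F ^^ n) ` piece x e"

context transitive_perfect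
begin

text \<open>An iterate meeting \<open>A\<close> and \<open>C\<close> contains \<open>B\<close> by
  connectedness, hence both \<open>b\<close> and \<open>(F ^^ k) b\<close>. It then overlaps its own
  \<open>k\<close>-th image, so the period divides \<open>k\<close>, which is too small.\<close>

lemma iterate_piece_not_between:
  assumes "x \<in> Y" "e > 0" "k < per x e"
    and k: "k \<ge> 1" "b \<in> B" "(F ^^ k) b \<in> B"
    and less: "\<forall>s\<in>A. \<forall>t\<in>B. s < t" "\<forall>s\<in>B. \<forall>t\<in>C. s < t"
    and meet: "a \<in> A \<inter> (F ^^ s) ` piece x e" "c \<in> C \<inter> (F ^^ s) ` piece x e"
  shows False
proof -
  let ?H = "(F ^^ s) ` piece x e"
  have conn: "connected ?H" by (intro connected_iterate connected_piece)
  have "t \<in> ?H" if "t \<in> B" for t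
  proof -
    have "a < t" "t < c" using less meet that by blast+
    then show ?thesis using connected_real_between[OF conn, of a c t] meet by simp
  qed
  then have "(F ^^ k) b \<in> (F ^^ k) ` ?H" "(F ^^ k) b \<in> ?H" using k(2,3) by simp_all
  then have "per x e dvd k" using iterate_piece_overlap[OF assms(1,2), of k s] by (meson disjoint_iff)
  then show False using dvd_imp_le[of "per x e" k] assms(3) k by simp
qed

text \<open>Overlapping iterates are nested, and the larger one would meet both \<open>A\<close> and
  \<open>C\<close>.\<close>

lemma iterates_piece_disjoint:
  assumes "x \<in> Y" "e > 0" "k < per x e"
    and k: "k \<ge> 1" "b \<in> B" "(F ^^ k) b \<in> B"
    and less: "\<forall>s\<in>A. \<forall>t\<in>B. s < t" "\<forall>s\<in>B. \<forall>t\<in>C. s < t"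
    and meet: "a \<in> A \<inter> (F ^^ s) ` piece x e" "c \<in> C \<inter> (F ^^ t) ` piece x e"
  shows "(F ^^ s) ` piece x e \<inter> (F ^^ t) ` piece x e = {}"
proof (rule ccontr)
  assume *: "\<not> ?thesis"
  note no = iterate_piece_not_between[OF assms(1-8)]
  show False
  proof (cases "s \<le> t")
    case True
    then have "(F ^^ t) ` piece x e \<subseteq> (F ^^ s) ` piece x e"
      using iterates_piece_nested(2)[OF assms(1,2)] * by blast
    then show False using no[of a s c] meet by blast
  next
    case False
    then have "(F ^^ s) ` piece x e \<subseteq> (F ^^ t) ` piece x e"
      using iterates_piece_nested(2)[OF assms(1,2), of t s] * by (simp add: Int_commute)
    then show False using no[of a t c] meet by blast
  qed
qed

end

context inseparable_gap
begin

section \<open>Position and motion of the gap\<close>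

lemma left_accumulates:
  assumes "r > 0"
  shows "{u - r<..<u} \<inter> Y \<noteq> {}"
proof -
  have "u \<in> {u - r<..<v} \<inter> Y" using uv assms by simp
  then obtain y where "y \<in> {u - r<..<v} \<inter> Y" "y \<noteq> u"
    using perfect[of "{u - r<..<v}" u] open_greaterThanLessThan by blast
  then have "y \<in> {u - r<..<u} \<inter> Y" using gap by force
  then show ?thesis by blast
qed

lemma right_accumulates:
  assumes "r > 0"
  shows "{v<..<v + r} \<inter> Y \<noteq> {}"
proof -
  have "v \<in> {u<..<v + r} \<inter> Y" using uv assms by simp
  then obtain y where "y \<in> {u<..<v + r} \<inter> Y" "y \<noteq> v"
    using perfect[of "{u<..<v + r}" v] open_greaterThanLessThan by blast
  then have "y \<in> {v<..<v + r} \<inter> Y" using gap by force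
  then show ?thesis by blast
qed

text \<open>
  Of three disjoint iterates of a piece that meet an interval from left to right, the middle one
  lies inside the interval.
\<close>

lemma gap_visits:
  assumes "open U" "U \<inter> Y \<noteq> {}"
  shows "\<exists>N. (F ^^ N) u \<in> U \<and> (F ^^ N) v \<in> U"
proof -
  obtain y \<rho> where y: "y \<in> Y" "\<rho> > 0" "ball y \<rho> \<subseteq> U" using assms by (meson disjoint_iff openE)
  have "ball y \<rho> \<inter> Y \<noteq> {}" using y centre_in_ball by blast
  with open_ball obtain V1 V2 V3 V where V: "open V1" "open V2" "open V3" "open V"
    "V1 \<subseteq> ball y \<rho>" "V2 \<subseteq> ball y \<rho>" "V3 \<subseteq> ball y \<rho>" "V \<subseteq> ball y \<rho>"
    "V1 \<inter> Y \<noteq> {}" "V2 \<inter> Y \<noteq> {}" "V3 \<inter> Y \<noteq> {}" "V \<inter> Y \<noteq> {}"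
    and less: "\<forall>s\<in>V1. \<forall>t\<in>V2. s < t" "\<forall>s\<in>V2. \<forall>t\<in>V3. s < t" "\<forall>s\<in>V3. \<forall>t\<in>V. s < t"
    by (rule split_open4)
  \<comment> \<open>The five sets are ordered from left to right. Iterates of a piece will meet
    \<open>V1\<close>, \<open>V3\<close> and \<open>V5\<close>; the return times of
    \<open>V2\<close> and \<open>V4\<close>, shorter than the period, keep neighbouring iterates
    disjoint.\<close>
  obtain V4 V5 where V45: "open V4" "open V5" "V4 \<subseteq> V" "V5 \<subseteq> V" "V4 \<inter> Y \<noteq> {}" "V5 \<inter> Y \<noteq> {}"
    and less45: "\<forall>s\<in>V4. \<forall>t\<in>V5. s < t"
    using split_open[OF V(4,12)] by metis
  obtain k b where k: "k \<ge> 1" "b \<in> V2" "(F ^^ k) b \<in> V2" using recurrent[OF V(2,10)] by blast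
  obtain l d where l: "l \<ge> 1" "d \<in> V4" "(F ^^ l) d \<in> V4" using recurrent[OF V45(1,5)] by blast
  obtain x e n where x: "x \<in> Y" "e > 0" and M: "per x e > k + l"
    and n: "u \<in> (F ^^ n) ` piece x e" "v \<in> (F ^^ n) ` piece x e"
    using deep[of "k + l"] by blast
  have B: "open (ball x e)" "ball x e \<inter> Y \<noteq> {}" using x centre_in_ball by blast+
  obtain s1 y1 where s1: "y1 \<in> ball x e" "(F ^^ s1) y1 \<in> V1"
    using transitive[OF B(1) V(1) B(2) V(9)] by blast
  obtain s3 y3 where s3: "y3 \<in> ball x e" "(F ^^ s3) y3 \<in> V3"
    using transitive[OF B(1) V(3) B(2) V(11)] by blast
  obtain s5 y5 where s5: "y5 \<in> ball x e" "(F ^^ s5) y5 \<in> V5"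
    using transitive[OF B(1) V45(2) B(2) V45(6)] by blast
  define H where "H s = (F ^^ s) ` piece x e" for s
  have h: "(F ^^ s1) y1 \<in> V1 \<inter> H s1" "(F ^^ s3) y3 \<in> V3 \<inter> H s3" "(F ^^ s5) y5 \<in> V5 \<inter> H s5"
    using s1 s3 s5 ball_piece[OF x(2), of x] by (auto simp: H_def)
  have "k < per x e" "l < per x e" using M by auto
  have less34: "\<forall>s\<in>V3. \<forall>t\<in>V4. s < t" using less(3) V45 by blast
  have disj: "H s1 \<inter> H s3 = {}" "H s3 \<inter> H s5 = {}"
    using iterates_piece_disjoint[OF x \<open>k < per x e\<close> k less(1,2)]
      iterates_piece_disjoint[OF x \<open>l < per x e\<close> l less34 less45] h
    unfolding H_def by blast+
  have conn: "connected (H s3)" unfolding H_def by (intro connected_iterate connected_piece)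
  have lt: "(F ^^ s1) y1 < (F ^^ s3) y3" "(F ^^ s3) y3 < (F ^^ s5) y5"
    using h less(1,2) k(2) less34 less45 l(2) by (force, force)
  have "H s3 \<subseteq> ball y \<rho>"
  proof
    fix t assume t: "t \<in> H s3"
    have "(F ^^ s1) y1 < t"
      using connected_real_between[OF conn t, of "(F ^^ s3) y3" "(F ^^ s1) y1"] h lt disj(1)
      by (meson IntE disjoint_iff less_imp_le not_less)
    moreover have "t < (F ^^ s5) y5"
      using connected_real_between[OF conn _ t, of "(F ^^ s3) y3" "(F ^^ s5) y5"] h lt disj(2)
      by (meson IntE disjoint_iff less_imp_le not_less)
    moreover have "(F ^^ s1) y1 \<in> ball y \<rho>" "(F ^^ s5) y5 \<in> ball y \<rho>" using h V V45 by blast+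
    ultimately show "t \<in> ball y \<rho>" by (auto simp: dist_real_def)
  qed
  \<comment> \<open>The exponent completes \<open>n\<close> to a multiple of the period before
    taking \<open>s3\<close> further steps.\<close>
  moreover have "(F ^^ (s3 + n * (per x e - 1))) c \<in> H s3" if "c \<in> (F ^^ n) ` piece x e" for c
  proof -
    let ?N = "s3 + n * (per x e - 1)"
    have N: "?N + n = s3 + per x e * n" using M by (cases "per x e") (auto simp: algebra_simps)
    have "(F ^^ ?N) c \<in> (F ^^ ?N) ` (F ^^ n) ` piece x e" using that by blast
    also have "\<dots> = (F ^^ s3) ` (F ^^ (per x e * n)) ` piece x e"
      by (simp only: N flip: funpow_image_add)
    also have "\<dots> \<subseteq> H s3"
      unfolding H_def by (intro image_mono iterate_piece x) simp
    finally show ?thesis .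
  qed
  ultimately show ?thesis using n y(3) by blast
qed

text \<open>Some time \<open>N\<close> takes both \<open>u\<close> and \<open>v\<close> into the
  ball about \<open>c\<close>, hence is a multiple of the period. A point of the ball that reaches
  \<open>Q\<close> at time \<open>n\<close> is back after \<open>N\<close> more steps, so
  \<open>n\<close> is a multiple as well and the point of \<open>Q\<close> lies in the
  piece.\<close>

lemma near_gap_meets_piece:
  assumes c: "c \<in> {u,v}" and b: "b \<in> {u,v}" and e: "e > 0"
  shows "\<exists>r>0. \<forall>Q. open Q \<longrightarrow> Q \<inter> Y \<noteq> {} \<longrightarrow> Q \<subseteq> ball b r \<longrightarrow> Q \<inter> piece c e \<noteq> {}"
proof -
  have cY: "c \<in> Y" using c uv by auto
  have B: "ball c e \<inter> Y \<noteq> {}" using cY e centre_in_ball by blast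
  obtain N where N: "(F ^^ N) u \<in> ball c e" "(F ^^ N) v \<in> ball c e"
    using gap_visits[OF open_ball B] by blast
  note bp = ball_piece[OF e, of c]
  have pN: "per c e dvd N"
    by (rule per_dvdI[OF cY e center_piece[OF e]]) (use N c bp in blast)
  have "b \<in> (F ^^ N) -` ball c e" using N b by auto
  then obtain r where r: "r > 0" "ball b r \<subseteq> (F ^^ N) -` ball c e"
    using open_preimage[OF open_ball] by (meson openE)
  have "Q \<inter> piece c e \<noteq> {}" if Q: "open Q" "Q \<inter> Y \<noteq> {}" "Q \<subseteq> ball b r" for Q
  proof -
    obtain n y where n: "y \<in> ball c e" "(F ^^ n) y \<in> Q"
      using transitive[OF open_ball Q(1) B Q(2)] by blast
    then have "(F ^^ (N + n)) y \<in> ball c e" using Q r by (auto simp: funpow_add)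
    then have "per c e dvd N + n" using per_dvdI[OF cY e, of y] n bp by blast
    then have "per c e dvd n" using pN by (simp add: dvd_add_right_iff)
    then have "(F ^^ n) y \<in> piece c e" using iterate_piece[OF cY e] n bp by blast
    then show ?thesis using n by blast
  qed
  then show ?thesis using r by blast
qed

text \<open>\<open>Y\<close> accumulates at \<open>u\<close> from the left and at \<open>v\<close>
  from the right, so the connected piece has points on both sides of the gap.\<close>

lemma gap_inside_piece:
  assumes c: "c \<in> {u,v}" and e: "e > 0"
  shows "\<exists>r>0. {u - r..v + r} \<subseteq> piece c e"
proof -
  obtain r1 where r1: "r1 > 0" "\<And>Q. open Q \<Longrightarrow> Q \<inter> Y \<noteq> {} \<Longrightarrow> Q \<subseteq> ball u r1 \<Longrightarrow> Q \<inter> piece c e \<noteq> {}"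
    using near_gap_meets_piece[OF c _ e, of u] by blast
  obtain r2 where r2: "r2 > 0" "\<And>Q. open Q \<Longrightarrow> Q \<inter> Y \<noteq> {} \<Longrightarrow> Q \<subseteq> ball v r2 \<Longrightarrow> Q \<inter> piece c e \<noteq> {}"
    using near_gap_meets_piece[OF c _ e, of v] by blast
  have "{u - r1<..<u} \<inter> piece c e \<noteq> {}"
    by (rule r1(2)) (use left_accumulates r1(1) in \<open>auto simp: dist_real_def\<close>)
  then obtain s where s: "s < u" "s \<in> piece c e" by auto
  have "{v<..<v + r2} \<inter> piece c e \<noteq> {}"
    by (rule r2(2)) (use right_accumulates r2(1) in \<open>auto simp: dist_real_def\<close>)
  then obtain t where t: "v < t" "t \<in> piece c e" by auto
  define r where "r = min (u - s) (t - v)"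
  have "{u - r..v + r} \<subseteq> {s..t}" by (auto simp: r_def)
  also have "\<dots> \<subseteq> piece c e" by (rule connected_contains_Icc[OF connected_piece s(2) t(2)])
  finally show ?thesis using s t by (intro exI[of _ r]) (auto simp: r_def)
qed

text \<open>A small ball about \<open>c\<close> is mapped into a ball whose piece has period above
  \<open>k\<close>, and this period divides that of the small ball.\<close>

lemma per_not_dvd:
  assumes c: "c \<in> {u,v}" and k: "k \<ge> 1"
  shows "\<exists>e0>0. \<forall>e. 0 < e \<and> e \<le> e0 \<longrightarrow> \<not> per c e dvd k"
proof -
  have cY: "c \<in> Y" using c uv by auto
  obtain x e where x: "x \<in> Y" "e > 0" "per x e > k" using deep[of k] by blast
  then have B: "ball x e \<inter> Y \<noteq> {}" using centre_in_ball by blast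
  obtain N where "(F ^^ N) u \<in> ball x e" "(F ^^ N) v \<in> ball x e"
    using gap_visits[OF open_ball B] by blast
  then have "c \<in> (F ^^ N) -` ball x e" using c by auto
  then obtain e0 where e0: "e0 > 0" "ball c e0 \<subseteq> (F ^^ N) -` ball x e"
    using open_preimage[OF open_ball] by (meson openE)
  have "\<not> per c e' dvd k" if e': "0 < e'" "e' \<le> e0" for e'
  proof
    assume *: "per c e' dvd k"
    have "ball c e' \<subseteq> (F ^^ N) -` ball x e" using e0 e' by force
    then have "(F ^^ N) ` ball c e' \<subseteq> piece x e" using ball_piece[OF x(2), of x] by blast
    then have "per x e dvd per c e'" by (rule per_dvd_per[OF x(1,2) cY e'(1)])
    then have "per x e dvd k" using * dvd_trans by blast
    then show False using dvd_imp_le[of "per x e" k] x k by simp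
  qed
  then show ?thesis using e0 by blast
qed

text \<open>The closed gap lies in every piece around \<open>u\<close>, so a point of it fixed by
  \<open>F ^^ k\<close> would force all periods at \<open>u\<close> to divide \<open>k\<close>,
  against \<open>per_not_dvd\<close>.\<close>

lemma no_periodic_point_in_gap:
  assumes "k \<ge> 1" "u \<le> z" "z \<le> v"
  shows "(F ^^ k) z \<noteq> z"
proof
  assume z: "(F ^^ k) z = z"
  obtain e where e: "e > 0" "\<not> per u e dvd k" using per_not_dvd[OF _ assms(1), of u] by auto
  obtain r where "r > 0" "{u - r..v + r} \<subseteq> piece u e" using gap_inside_piece[of u] e by auto
  then have "z \<in> piece u e" using assms by force
  then show False using per_dvdI[OF uv(2) e(1), of z k] z e by simp
qed

text \<open>The piece is a neighbourhood of both \<open>u\<close> and \<open>v\<close>, so the ball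
  about \<open>c\<close> can be shrunk into it. Start and target then lie in one piece, which makes
  the travel time a multiple of its period.\<close>

lemma reach:
  assumes x: "x \<in> {u,v}" "e > 0" and c: "c \<in> {u,v}" "d > 0"
    and W: "open W" "W \<inter> Y \<noteq> {}" "W \<subseteq> piece x e"
  shows "\<exists>n\<ge>N. per x e dvd n \<and> (\<exists>y\<in>ball c d. (F ^^ n) y \<in> W)"
proof -
  have xY: "x \<in> Y" "c \<in> Y" using x c uv by auto
  obtain r where r: "r > 0" "{u - r..v + r} \<subseteq> piece x e" using gap_inside_piece[OF x] by blast
  define d' where "d' = min d r"
  have d': "d' > 0" "d' \<le> d" "d' \<le> r" using c r by (auto simp: d'_def)
  have "ball c d' \<inter> Y \<noteq> {}" using xY d' centre_in_ball by blast
  then obtain n y where n: "n \<ge> N" "y \<in> ball c d'" "(F ^^ n) y \<in> W"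
    using transitive_ge[OF open_ball W(1) _ W(2)] by blast
  have "ball c d' \<subseteq> {u - r..v + r}" using c uv(1) d' by (auto simp: dist_real_def)
  then have "per x e dvd n" by (intro per_dvdI[OF xY(1) x(2), of y]) (use n W r in blast)+
  moreover have "y \<in> ball c d" using n d' by auto
  ultimately show ?thesis using n by blast
qed

text \<open>Aim first at the points of \<open>ball x e\<close> that enter \<open>A\<close> at time
  \<open>j\<close>, then wait \<open>j\<close> more steps.\<close>

lemma reach_beyond:
  assumes x: "x \<in> {u,v}" "e > 0" and c: "c \<in> {u,v}" "d > 0"
    and y: "y \<in> Y \<inter> ball x e" "per x e dvd j" "(F ^^ j) y \<in> A" "open A"
  shows "\<exists>n\<ge>N. per x e dvd n \<and> (\<exists>w\<in>ball c d. (F ^^ n) w \<in> A)"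
proof -
  define W where "W = ball x e \<inter> (F ^^ j) -` A"
  have "open W" unfolding W_def by (intro open_Int open_ball open_preimage y)
  moreover have "W \<inter> Y \<noteq> {}" "W \<subseteq> piece x e"
    using y ball_piece[OF x(2), of x] by (auto simp: W_def)
  ultimately obtain n w where n: "n \<ge> N" "per x e dvd n" "w \<in> ball c d" "(F ^^ n) w \<in> W"
    using reach[OF x c] by blast
  then have "(F ^^ (j + n)) w \<in> A" by (simp add: W_def funpow_add)
  then show ?thesis using n y(2) by (intro exI[of _ "j + n"]) auto
qed

text \<open>
  The gap is moved as a whole: it stays in an iterate of a small piece, which is disjoint from
  the piece itself.
\<close>

lemma gap_moves_beyond:
  assumes x: "x \<in> {u,v}" "e > 0" and T: "T = {..<u} \<or> T = {v<..}"
  shows "\<exists>n\<ge>N. per x e dvd n \<and> (F ^^ n) u \<in> T \<and> (F ^^ n) v \<in> T"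
proof -
  have xY: "x \<in> Y" using x uv by auto
  obtain r where r: "r > 0" "{u - r..v + r} \<subseteq> piece x e" using gap_inside_piece[OF x] by blast
  define U where "U = (if T = {..<u} then {u - r<..<u} else {v<..<v + r})"
  have U: "open U" "U \<inter> Y \<noteq> {}" "U \<subseteq> {u - r..v + r}"
    using left_accumulates right_accumulates r(1) uv(1) by (auto simp: U_def)
  obtain V W where VW: "open V" "open W" "V \<subseteq> U" "W \<subseteq> U" "V \<inter> Y \<noteq> {}" "W \<inter> Y \<noteq> {}"
    and less: "\<forall>s\<in>V. \<forall>t\<in>W. s < t"
    using split_open[OF U(1,2)] by metis
  \<comment> \<open>\<open>mid\<close> lies between \<open>far\<close> and the gap. It will contain
    a point outside \<open>D\<close>, which prevents an iterate of \<open>D\<close> that reaches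
    \<open>far\<close> from meeting \<open>D\<close>.\<close>
  define far where "far = (if T = {..<u} then V else W)"
  define mid where "mid = (if T = {..<u} then W else V)"
  have far: "open far" "far \<inter> Y \<noteq> {}" "far \<subseteq> U" and mid: "open mid" "mid \<inter> Y \<noteq> {}" "mid \<subseteq> U"
    using VW by (auto simp: far_def mid_def)
  obtain k b where k: "k \<ge> 1" "b \<in> mid" "(F ^^ k) b \<in> mid" using recurrent[OF mid(1,2)] by blast
  obtain e0 where e0: "e0 > 0" "\<And>e. 0 < e \<Longrightarrow> e \<le> e0 \<Longrightarrow> \<not> per u e dvd k"
    using per_not_dvd[OF _ k(1), of u] by auto
  define e1 where "e1 = min e0 r"
  have e1: "e1 > 0" "e1 \<le> e0" "e1 \<le> r" using e0 r by (auto simp: e1_def)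
  define D where "D = piece u e1"
  \<comment> \<open>Both \<open>b\<close> and its return lying in \<open>D\<close> would make
    \<open>k\<close> a multiple of the period of \<open>D\<close>.\<close>
  obtain m where m: "m \<in> mid" "m \<notin> D"
    using per_dvdI[OF uv(2) e1(1), of b k] e0(2)[OF e1(1,2)] k unfolding D_def by blast
  obtain r' where "r' > 0" "{u - r'..v + r'} \<subseteq> D"
    using gap_inside_piece[of u] e1 unfolding D_def by auto
  then have D: "{u..v} \<subseteq> D" by force
  have "far \<subseteq> piece x e" using far U r by blast
  then obtain n y where n: "n \<ge> N" "per x e dvd n" "y \<in> ball u e1" "(F ^^ n) y \<in> far"
    using reach[OF x _ e1(1) far(1,2), of u N] by blast
  have y: "y \<in> D" using n ball_piece[OF e1(1), of u] by (auto simp: D_def)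
  have conn: "connected D" "connected ((F ^^ n) ` D)"
    unfolding D_def by (intro connected_iterate connected_piece)+
  have disj: "(F ^^ n) ` D \<inter> D = {}"
  proof (rule ccontr)
    assume "(F ^^ n) ` D \<inter> D \<noteq> {}"
    then have "(F ^^ n) ` D \<subseteq> D" unfolding D_def by (rule iterate_piece_absorb)
    then have yD: "(F ^^ n) y \<in> D" using y by blast
    have uD: "u \<in> D" "v \<in> D" using D uv(1) by auto
    show False
    proof (cases "T = {..<u}")
      case True
      then have "(F ^^ n) y < m" "m < u" using less n m mid(3) by (auto simp: far_def mid_def U_def)
      then show False using connected_real_between[OF conn(1) yD uD(1), of m] m by simp
    next
      case False
      then have "m < (F ^^ n) y" "v < m" using less n m mid(3) by (auto simp: far_def mid_def U_def)
      then show False using connected_real_between[OF conn(1) uD(2) yD, of m] m by simp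
    qed
  qed
  have "(F ^^ n) c \<in> T" if c: "c \<in> {u,v}" for c
  proof -
    have uD: "u \<in> D" "v \<in> D" using D uv(1) by auto
    then have "c \<in> D" using c by auto
    then have cD: "(F ^^ n) c \<in> (F ^^ n) ` D" and yD: "(F ^^ n) y \<in> (F ^^ n) ` D"
      using y by blast+
    show ?thesis
    proof (cases "T = {..<u}")
      case True
      then have "(F ^^ n) y < u" using n far by (auto simp: U_def)
      then have "\<not> u \<le> (F ^^ n) c"
        using connected_real_between[OF conn(2) yD cD, of u] uD disj by auto
      then show ?thesis using True by simp
    next
      case False
      then have "v < (F ^^ n) y" using n far by (auto simp: U_def)
      then have "\<not> (F ^^ n) c \<le> v"
        using connected_real_between[OF conn(2) cD yD, of v] uD disj by auto
      then show ?thesis using False T by simp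
    qed
  qed
  then show ?thesis using n by blast
qed

text \<open>Late iterates of the two balls contain the fixed points \<open>zu\<close> and
  \<open>zv\<close>, which lie off the gap. If these are on the same side, it suffices to move
  \<open>u\<close> and \<open>v\<close> to the other side at one time. If they are on opposite
  sides, the iterates of \<open>ball u e\<close> are first made to contain \<open>zv\<close> too,
  and those of \<open>ball v d\<close> then need one point on the side of \<open>zu\<close>.\<close>

lemma common_straddling_time:
  assumes e: "e > 0"
  obtains n where "\<exists>s\<in>(F ^^ n) ` ball u e. s < u" "\<exists>t\<in>(F ^^ n) ` ball u e. v < t"
    "\<exists>s\<in>(F ^^ n) ` ball v e. s < u" "\<exists>t\<in>(F ^^ n) ` ball v e. v < t"
proof -
  obtain r where r: "r > 0" "{u - r..v + r} \<subseteq> piece u e" using gap_inside_piece[of u e] e by auto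
  \<comment> \<open>Small enough that \<open>p\<close> divides \<open>q\<close>, so multiples of
    \<open>q\<close> serve both balls.\<close>
  define d where "d = min e r"
  have d: "d > 0" "d \<le> e" "d \<le> r" using e r by (auto simp: d_def)
  define p where "p = per u e"
  define q where "q = per v d"
  have "ball v d \<subseteq> {u - r..v + r}" using d uv(1) by (auto simp: dist_real_def)
  then have "ball v d \<subseteq> piece u e" using r by blast
  then have pq: "p dvd q"
    unfolding p_def q_def by (intro per_dvd_per[OF uv(2) e uv(3) d(1), of 0]) simp
  have pos: "p \<ge> 1" "q \<ge> 1" using per_pos uv e d by (auto simp: p_def q_def)
  obtain zu yu ju ju' where zu: "(F ^^ p) zu = zu" and yu: "yu \<in> Y \<inter> ball u e"
    "p dvd ju" "p dvd ju'" "(F ^^ ju) yu < zu" "zu < (F ^^ ju') yu"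
    using fixed_point_in_piece[OF uv(2) e] unfolding p_def by blast
  obtain zv yv jv jv' where zv: "(F ^^ q) zv = zv" and yv: "yv \<in> Y \<inter> ball v d"
    "q dvd jv" "q dvd jv'" "(F ^^ jv) yv < zv" "zv < (F ^^ jv') yv"
    using fixed_point_in_piece[OF uv(3) d(1)] unfolding q_def by blast
  have "yu \<in> piece u e" "yv \<in> piece v d" using yu(1) yv(1) ball_piece e d(1) by blast+
  then have "zu \<in> piece u e" "zv \<in> piece v d"
    using between_in_piece[OF uv(2) e _ yu(2,3)[unfolded p_def] yu(4,5)]
      between_in_piece[OF uv(3) d(1) _ yv(2,3)[unfolded q_def] yv(4,5)] by simp_all
  then obtain nu nv where "\<And>n. n \<ge> nu \<Longrightarrow> p dvd n \<Longrightarrow> zu \<in> (F ^^ n) ` ball u e"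
    "\<And>n. n \<ge> nv \<Longrightarrow> q dvd n \<Longrightarrow> zv \<in> (F ^^ n) ` ball v d"
    using fixed_covered[OF uv(2) e] fixed_covered[OF uv(3) d(1)] zu zv
    unfolding p_def q_def by metis
  then have cov: "zu \<in> (F ^^ n) ` ball u e" "zv \<in> (F ^^ n) ` ball v d"
    if "n \<ge> max nu nv" "q dvd n" for n
    using that pq dvd_trans by auto
  have "zu < u \<or> v < zu" "zv < u \<or> v < zv"
    using no_periodic_point_in_gap[OF pos(1), of zu] no_periodic_point_in_gap[OF pos(2), of zv]
      zu zv not_le by blast+
  define str where "str S \<longleftrightarrow> (\<exists>s\<in>S. s < u) \<and> (\<exists>t\<in>S. v < t)" for S
  have strI: "str S" if "s \<in> S" "s < u" "t \<in> S" "v < t" for s t S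
    using that unfolding str_def by blast
  from \<open>zu < u \<or> v < zu\<close> \<open>zv < u \<or> v < zv\<close>
  consider (same) "zu < u \<and> zv < u \<or> v < zu \<and> v < zv"
    | (opposite) "zu < u \<and> v < zv \<or> v < zu \<and> zv < u" by blast
  then have "\<exists>n. str ((F ^^ n) ` ball u e) \<and> str ((F ^^ n) ` ball v d)"
  proof cases
    case same
    \<comment> \<open>The side of the gap opposite to both fixed points.\<close>
    define T where "T = (if v < zu then {..<u} else {v<..})"
    obtain n where n: "n \<ge> max nu nv" "q dvd n" "(F ^^ n) u \<in> T" "(F ^^ n) v \<in> T"
      using gap_moves_beyond[OF _ d(1), of v T "max nu nv"] unfolding q_def T_def by (metis insertI1 insertI2)
    have "(F ^^ n) u \<in> (F ^^ n) ` ball u e" "(F ^^ n) v \<in> (F ^^ n) ` ball v d" using e d by auto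
    moreover have "zu \<in> (F ^^ n) ` ball u e" "zv \<in> (F ^^ n) ` ball v d" using cov n by blast+
    ultimately have "str ((F ^^ n) ` ball u e) \<and> str ((F ^^ n) ` ball v d)"
      using n(3,4) same uv(1) strI[of "(F ^^ n) u" _ zu] strI[of zu _ "(F ^^ n) u"]
        strI[of "(F ^^ n) v" _ zv] strI[of zv _ "(F ^^ n) v"]
      by (cases "v < zu") (simp_all add: T_def)
    then show ?thesis by blast
  next
    case opposite
    \<comment> \<open>\<open>A\<close> lies beyond \<open>zv\<close> as seen from \<open>zu\<close>,
      so an iterate of \<open>ball u e\<close> containing \<open>zu\<close> and meeting
      \<open>A\<close> contains \<open>zv\<close>.\<close>
    define A where "A = (if zu < u then {zv<..} else {..<zv})"
    define j where "j = (if zu < u then jv' else jv)"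
    have "open A" "q dvd j" "(F ^^ j) yv \<in> A" using yv by (auto simp: A_def j_def)
    then obtain m w where m: "m \<ge> max nu nv" "q dvd m" "w \<in> ball u e" "(F ^^ m) w \<in> A"
      using reach_beyond[OF _ d(1) _ e yv(1), of u j A "max nu nv"] unfolding q_def by blast
    have "connected ((F ^^ m) ` ball u e)" by (intro connected_iterate connected_ball)
    then have zvm: "zv \<in> (F ^^ m) ` ball u e"
      using connected_real_between[of "(F ^^ m) ` ball u e" zu "(F ^^ m) w" zv]
        connected_real_between[of "(F ^^ m) ` ball u e" "(F ^^ m) w" zu zv]
        m cov(1)[OF m(1,2)] opposite uv(1) by (auto simp: A_def split: if_splits)
    have zv_n: "zv \<in> (F ^^ n) ` ball u e" if "n \<ge> m" "q dvd n" for n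
    proof -
      have "(F ^^ (n - m)) zv = zv" by (rule funpow_fixed[OF zv]) (use that m in simp)
      moreover have "(F ^^ n) ` ball u e = (F ^^ (n - m)) ` (F ^^ m) ` ball u e"
        using that(1) by (simp flip: funpow_image_add)
      ultimately show ?thesis using zvm by (metis imageI)
    qed
    obtain r' where r': "r' > 0" "{u - r'..v + r'} \<subseteq> piece v d"
      using gap_inside_piece[of v d] d by auto
    \<comment> \<open>Next to the gap, on the side of \<open>zu\<close> and hence opposite to
      \<open>zv\<close>.\<close>
    define W where "W = (if zu < u then {u - r'<..<u} else {v<..<v + r'})"
    have W: "open W" "W \<inter> Y \<noteq> {}" "W \<subseteq> {u - r'..v + r'}"
      using left_accumulates right_accumulates r'(1) uv(1) by (auto simp: W_def)
    then have "W \<subseteq> piece v d" using r' by blast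
    then obtain n y where n: "n \<ge> m" "q dvd n" "y \<in> ball v d" "(F ^^ n) y \<in> W"
      using reach[OF _ d(1) _ d(1) W(1,2), of v v m] unfolding q_def by blast
    have "(F ^^ n) y \<in> (F ^^ n) ` ball v d" using n by blast
    moreover have "zu \<in> (F ^^ n) ` ball u e" "zv \<in> (F ^^ n) ` ball v d"
      using cov[of n] n m by auto
    moreover have "zv \<in> (F ^^ n) ` ball u e" using zv_n n by blast
    ultimately have "str ((F ^^ n) ` ball u e) \<and> str ((F ^^ n) ` ball v d)"
      using n(4) opposite uv(1) strI[of zu _ zv] strI[of zv _ zu]
        strI[of "(F ^^ n) y" _ zv] strI[of zv _ "(F ^^ n) y"]
      by (cases "zu < u") (simp_all add: W_def)
    then show ?thesis by blast
  qed
  moreover have "(F ^^ n) ` ball v d \<subseteq> (F ^^ n) ` ball v e" for n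
    using d by (intro image_mono) auto
  ultimately show ?thesis using that unfolding str_def by (meson subsetD)
qed

text \<open>A connected image with points on both sides of the gap contains a neighbourhood of the
  closed gap.\<close>

lemma straddled_pair_gap: "straddled_pair F u v"
  unfolding straddled_pair_def
proof (intro conjI allI impI)
  fix e :: real assume "e > 0"
  then obtain n where *: "\<exists>s\<in>(F ^^ n) ` ball u e. s < u" "\<exists>t\<in>(F ^^ n) ` ball u e. v < t"
    "\<exists>s\<in>(F ^^ n) ` ball v e. s < u" "\<exists>t\<in>(F ^^ n) ` ball v e. v < t"
    by (rule common_straddling_time)
  have "\<exists>r>0. {u - r..v + r} \<subseteq> S"
    if S: "connected S" "\<exists>s\<in>S. s < u" "\<exists>t\<in>S. v < t" for S
  proof -
    obtain s t where st: "s \<in> S" "s < u" "t \<in> S" "v < t" using S by blast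
    define r where "r = min (u - s) (t - v)"
    have "{u - r..v + r} \<subseteq> {s..t}" by (auto simp: r_def)
    also have "\<dots> \<subseteq> S" by (rule connected_contains_Icc[OF S(1) st(1,3)])
    finally show ?thesis using st by (intro exI[of _ r]) (auto simp: r_def)
  qed
  note enclosed = this
  have conn: "connected ((F ^^ n) ` ball c e)" for c by (intro connected_iterate connected_ball)
  obtain r where r: "r > 0" "{u - r..v + r} \<subseteq> (F ^^ n) ` ball u e"
    using enclosed[OF conn *(1,2)] by blast
  obtain r' where r': "r' > 0" "{u - r'..v + r'} \<subseteq> (F ^^ n) ` ball v e"
    using enclosed[OF conn *(3,4)] by blast
  let ?r = "min r r'"
  have "ball u ?r \<union> ball v ?r \<subseteq> {u - r..v + r} \<inter> {u - r'..v + r'}"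
    using uv(1) by (auto simp: dist_real_def)
  then have "ball u ?r \<union> ball v ?r \<subseteq> (F ^^ n) ` ball u e \<inter> (F ^^ n) ` ball v e"
    using r r' by blast
  then show "\<exists>n. \<exists>e'>0. ball u e' \<union> ball v e' \<subseteq> (F ^^ n) ` ball u e \<inter> (F ^^ n) ` ball v e"
    using r r' by (intro exI[of _ n] exI[of _ ?r]) auto
qed (use uv in simp)

end

text \<open>By sensitivity, pieces of arbitrarily large period have iterates containing two points
  of \<open>Y\<close> at distance at least \<open>\<delta>\<close>; compactness gives a limit pair.
  A point of \<open>Y\<close> strictly between the limits would have a neighbourhood with return
  time \<open>k\<close> inside an iterate of a piece of period above \<open>k\<close>.\<close>

lemma (in transitive_perfect) inseparable_gap_exists:
  assumes "compact Y" and \<delta>: "\<delta> > 0"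
    and sens: "\<And>x e. x \<in> Y \<Longrightarrow> e > 0 \<Longrightarrow> \<exists>y\<in>Y \<inter> ball x e. \<exists>n. dist ((F ^^ n) x) ((F ^^ n) y) \<ge> \<delta>"
    and unbounded: "\<And>M. \<exists>x\<in>Y. \<exists>e>0. per x e > M"
  shows "\<exists>u v. inseparable_gap F Y u v"
proof -
  let ?P = "\<lambda>m ab. ab \<in> Y \<times> Y \<and> fst ab + \<delta> \<le> snd ab \<and>
    (\<exists>x\<in>Y. \<exists>e>0. \<exists>n. per x e > m \<and> fst ab \<in> (F ^^ n) ` piece x e \<and> snd ab \<in> (F ^^ n) ` piece x e)"
  have "\<exists>ab. ?P m ab" for m
  proof -
    obtain x e where x: "x \<in> Y" "e > 0" "per x e > m" using unbounded by blast
    obtain y n where y: "y \<in> Y" "y \<in> ball x e" "dist ((F ^^ n) x) ((F ^^ n) y) \<ge> \<delta>"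
      using sens[OF x(1,2)] by blast
    have "x \<in> piece x e" "y \<in> piece x e" using ball_piece[OF x(2), of x] x y by auto
    then have "(F ^^ n) x \<in> (F ^^ n) ` piece x e" "(F ^^ n) y \<in> (F ^^ n) ` piece x e" by blast+
    moreover have "(F ^^ n) x \<in> Y" "(F ^^ n) y \<in> Y" using iterate_in x y by auto
    moreover have "(F ^^ n) x + \<delta> \<le> (F ^^ n) y \<or> (F ^^ n) y + \<delta> \<le> (F ^^ n) x"
      using y(3) by (auto simp: dist_real_def abs_if split: if_splits)
    ultimately have "?P m ((F ^^ n) x, (F ^^ n) y) \<or> ?P m ((F ^^ n) y, (F ^^ n) x)"
      using x by auto
    then show ?thesis by blast
  qed
  then obtain ab where ab: "\<And>m. ?P m (ab m)" by metis
  have "compact (Y \<times> Y)" using assms(1) by (intro compact_Times)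
  then obtain l r where l: "l \<in> Y \<times> Y" "strict_mono r" "(ab \<circ> r) \<longlonglongrightarrow> l"
    using ab unfolding compact_def by metis
  obtain u v where uv: "l = (u, v)" by (cases l)
  define A where "A i = fst (ab (r i))" for i
  define B where "B i = snd (ab (r i))" for i
  have lim: "A \<longlonglongrightarrow> u" "B \<longlonglongrightarrow> v"
    using tendsto_fst[OF l(3)] tendsto_snd[OF l(3)] by (simp_all add: A_def[abs_def] B_def[abs_def] uv o_def)
  have AB: "A i \<in> Y" "B i \<in> Y" "A i + \<delta> \<le> B i" for i
    using ab[of "r i"] by (auto simp: A_def B_def)
  have "u + \<delta> \<le> v"
    by (rule LIMSEQ_le[OF tendsto_add[OF lim(1) tendsto_const] lim(2)]) (use AB in auto)
  then have less: "u < v" using \<delta> by simp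
  have inside: "\<exists>x\<in>Y. \<exists>e>0. \<exists>n. per x e > M \<and> A i \<in> (F ^^ n) ` piece x e \<and> B i \<in> (F ^^ n) ` piece x e"
    if "i \<ge> M" for i M
  proof -
    have "M \<le> r i" using strict_mono_imp_increasing[OF l(2), of i] that by linarith
    then show ?thesis using ab[of "r i"] unfolding A_def B_def by (meson le_less_trans)
  qed
  have enclosed: "\<exists>x\<in>Y. \<exists>e>0. \<exists>n. per x e > M \<and> {s..t} \<subseteq> (F ^^ n) ` piece x e"
    if ev: "\<forall>\<^sub>F i in sequentially. A i \<le> s" "\<forall>\<^sub>F i in sequentially. t \<le> B i" for s t M
  proof -
    have "\<forall>\<^sub>F i in sequentially. A i \<le> s \<and> t \<le> B i \<and> i \<ge> M"
      using ev eventually_ge_at_top[of M] by (intro eventually_conj)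
    then obtain i where i: "A i \<le> s" "t \<le> B i" "i \<ge> M"
      using eventually_happens'[OF sequentially_bot] by blast
    obtain x e n where x: "x \<in> Y" "e > 0" "per x e > M"
      "A i \<in> (F ^^ n) ` piece x e" "B i \<in> (F ^^ n) ` piece x e"
      using inside[OF i(3)] by blast
    have "{s..t} \<subseteq> {A i..B i}" using i by auto
    also have "\<dots> \<subseteq> (F ^^ n) ` piece x e"
      by (rule connected_contains_Icc[OF connected_iterate[OF connected_piece] x(4,5)])
    finally have "{s..t} \<subseteq> (F ^^ n) ` piece x e" .
    then show ?thesis using x by blast
  qed
  have gap: "{u<..<v} \<inter> Y = {}"
  proof (rule ccontr)
    assume "\<not> ?thesis"
    then obtain y where y: "y \<in> Y" "u < y" "y < v" by auto
    obtain s t where st: "u < s" "s < y" "y < t" "t < v" using y dense by meson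
    have "{s<..<t} \<inter> Y \<noteq> {}" using y st by auto
    then obtain k w where k: "k \<ge> 1" "w \<in> {s<..<t}" "(F ^^ k) w \<in> {s<..<t}"
      using recurrent[OF open_greaterThanLessThan] by blast
    have "\<forall>\<^sub>F i in sequentially. A i \<le> s" "\<forall>\<^sub>F i in sequentially. t \<le> B i"
      using order_tendstoD(2)[OF lim(1) st(1)] order_tendstoD(1)[OF lim(2) st(4)]
      by (auto elim: eventually_mono)
    then obtain x e n where x: "x \<in> Y" "e > 0" "per x e > k" "{s..t} \<subseteq> (F ^^ n) ` piece x e"
      using enclosed[of s t k] by blast
    have "w \<in> {s..t}" "(F ^^ k) w \<in> {s..t}" using k by auto
    then have "(F ^^ k) w \<in> (F ^^ k) ` (F ^^ n) ` piece x e" "(F ^^ k) w \<in> (F ^^ n) ` piece x e"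
      using x(4) by blast+
    then have "per x e dvd k" using iterate_piece_overlap[OF x(1,2), of k n] by (meson disjoint_iff)
    then show False using dvd_imp_le[of "per x e" k] x(3) k(1) by simp
  qed
  \<comment> \<open>\<open>A i\<close> lies in \<open>Y\<close> and is eventually below
    \<open>v\<close>, so the empty gap forces it to \<open>u\<close> or further left. Hence the
    iterates contain the endpoints of the gap too.\<close>
  have "\<forall>\<^sub>F i in sequentially. A i \<le> u"
    using order_tendstoD(2)[OF lim(1) less]
    by (rule eventually_mono) (use AB(1) gap in \<open>force simp: not_le[symmetric]\<close>)
  moreover have "\<forall>\<^sub>F i in sequentially. v \<le> B i"
    using order_tendstoD(1)[OF lim(2) less]
    by (rule eventually_mono) (use AB(2) gap in \<open>force simp: not_le[symmetric]\<close>)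
  ultimately have "\<exists>x\<in>Y. \<exists>e>0. \<exists>n. per x e > M \<and> {u..v} \<subseteq> (F ^^ n) ` piece x e" for M
    using enclosed by blast
  moreover have "u \<in> {u..v}" "v \<in> {u..v}" using less by auto
  ultimately have "\<exists>x\<in>Y. \<exists>e>0. \<exists>n. per x e > M \<and>
      u \<in> (F ^^ n) ` piece x e \<and> v \<in> (F ^^ n) ` piece x e" for M
    by (meson subsetD)
  then have "inseparable_gap F Y u v"
    by unfold_locales (use less l(1) uv gap in auto)
  then show ?thesis by blast
qed

section \<open>Wiggins chaos implies Li-Yorke chaos\<close>

theorem theorem1p7:
  fixes a b :: real and f :: "real \<Rightarrow> real"
  assumes "a \<le> b"
    and "continuous_on {a..b} f"
    and "f ` {a..b} \<subseteq> {a..b}"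
    and "wiggins_chaotic {a..b} f"
  shows "li_yorke_chaotic {a..b} f"
proof -
  define F where "F x = f (max a (min b x))" for x
  have cl: "max a (min b x) \<in> {a..b}" for x using assms(1) by auto
  have contF: "continuous_on UNIV F"
    unfolding F_def
    by (rule continuous_on_compose2[OF assms(2)]) (use cl in \<open>auto intro!: continuous_intros\<close>)
  have rangeF: "range F \<subseteq> {a..b}" using assms(3) cl unfolding F_def by blast
  have Ff: "F x = f x" if "x \<in> {a..b}" for x using that by (simp add: F_def)
  have iter: "(f ^^ n) x = (F ^^ n) x" if "x \<in> {a..b}" for n x
  proof (induction n)
    case (Suc n)
    have "F y \<in> {a..b}" for y using rangeF by blast
    then have "(F ^^ n) x \<in> {a..b}" using that by (cases n) simp_all
    then show ?case using Suc Ff by simp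
  qed simp
  obtain Y where Y: "Y \<noteq> {}" "closedin (top_of_set {a..b}) Y" "f ` Y \<subseteq> Y"
    and tr: "transitive_map Y f" and se: "sensitive_map Y f"
    using assms(4) unfolding wiggins_chaotic_def by blast
  have sub: "Y \<subseteq> {a..b}" using Y(2) closedin_imp_subset by blast
  have comp: "compact Y" using Y(2) closedin_compact compact_Icc by blast
  obtain \<delta> where \<delta>: "\<delta> > 0" and sens_nbhd: "\<And>x U. x \<in> Y \<Longrightarrow> neighbourhood_in Y x U \<Longrightarrow>
      \<exists>y\<in>U. \<exists>n. dist ((f ^^ n) x) ((f ^^ n) y) \<ge> \<delta>"
    using se unfolding sensitive_map_def by blast
  have sens: "\<exists>y\<in>Y \<inter> U. \<exists>n. dist ((F ^^ n) x) ((F ^^ n) y) \<ge> \<delta>"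
    if x: "x \<in> Y" "open U" "x \<in> U" for x U
  proof -
    have "openin (top_of_set Y) (Y \<inter> U)" using x by (simp add: openin_open_Int)
    then have "neighbourhood_in Y x (Y \<inter> U)"
      unfolding neighbourhood_in_def using x by blast
    then obtain y n where y: "y \<in> Y \<inter> U" "dist ((f ^^ n) x) ((f ^^ n) y) \<ge> \<delta>"
      using sens_nbhd[OF x(1)] by blast
    moreover have "x \<in> {a..b}" "y \<in> {a..b}" using x y sub by auto
    ultimately show ?thesis using iter by metis
  qed
  interpret transitive_perfect F Y
  proof
    show "continuous_on UNIV F" by (rule contF)
    show "F ` Y \<subseteq> Y" using Y(3) sub Ff by force
    show "\<exists>n. \<exists>y\<in>U \<inter> Y. (F ^^ n) y \<in> V"
      if "open U" "open V" "U \<inter> Y \<noteq> {}" "V \<inter> Y \<noteq> {}" for U V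
    proof -
      have "openin (top_of_set Y) (Y \<inter> U)" "openin (top_of_set Y) (Y \<inter> V)"
        using that by (simp_all add: openin_open_Int)
      moreover have "Y \<inter> U \<noteq> {}" "Y \<inter> V \<noteq> {}" using that by blast+
      ultimately obtain n where "(f ^^ n) -` (Y \<inter> V) \<inter> (Y \<inter> U) \<noteq> {}"
        using tr unfolding transitive_map_def by meson
      then obtain y where "y \<in> Y \<inter> U" "(f ^^ n) y \<in> V" by blast
      then have "y \<in> U \<inter> Y \<and> (F ^^ n) y \<in> V" using iter[of y n] sub by auto
      then show ?thesis by blast
    qed
    \<comment> \<open>Sensitivity excludes isolated points: a point separated from \<open>y\<close>
      by \<open>\<delta> > 0\<close> at some time differs from \<open>y\<close>.\<close>
    show "\<exists>y'\<in>U \<inter> Y. y' \<noteq> y" if "open U" "y \<in> U \<inter> Y" for U y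
    proof -
      obtain y' n where "y' \<in> Y \<inter> U" "dist ((F ^^ n) y) ((F ^^ n) y') \<ge> \<delta>"
        using sens[of y U] \<open>open U\<close> \<open>y \<in> U \<inter> Y\<close> by blast
      moreover have "y' \<noteq> y" using calculation(2) \<delta> by auto
      ultimately show ?thesis by blast
    qed
  qed
  have "\<exists>u v. straddled_pair F u v"
  proof (cases "\<exists>M. \<forall>x\<in>Y. \<forall>e>0. per x e \<le> M")
    case True
    then show ?thesis using straddled_pair_if_per_bounded[OF Y(1)] by blast
  next
    case False
    then have unb: "\<exists>x\<in>Y. \<exists>e>0. per x e > M" for M by (meson not_le)
    have "\<exists>y\<in>Y \<inter> ball x e. \<exists>n. dist ((F ^^ n) x) ((F ^^ n) y) \<ge> \<delta>" if "x \<in> Y" "e > 0" for x e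
      using sens[of x "ball x e"] that by simp
    then obtain u v where "inseparable_gap F Y u v"
      using inseparable_gap_exists[OF comp \<delta> _ unb] by blast
    then show ?thesis using inseparable_gap.straddled_pair_gap by blast
  qed
  then obtain u v where "straddled_pair F u v" by blast
  then have "li_yorke_chaotic {a..b} F"
    unfolding straddled_pair_def by (intro li_yorke_criterion[OF contF rangeF, of u v]) blast+
  then obtain S where S: "S \<subseteq> {a..b}" "uncountable S" and scrambled: "\<And>x y. x \<in> S \<Longrightarrow> y \<in> S \<Longrightarrow> x \<noteq> y \<Longrightarrow>
      limsup (\<lambda>n. ereal (dist ((F ^^ n) x) ((F ^^ n) y))) > 0 \<and>
      liminf (\<lambda>n. ereal (dist ((F ^^ n) x) ((F ^^ n) y))) = 0"
    unfolding li_yorke_chaotic_def by blast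
  have "(\<lambda>n. ereal (dist ((f ^^ n) x) ((f ^^ n) y))) = (\<lambda>n. ereal (dist ((F ^^ n) x) ((F ^^ n) y)))"
    if "x \<in> S" "y \<in> S" for x y
    using iter S(1) that by (auto simp: subset_iff)
  then show ?thesis
    unfolding li_yorke_chaotic_def using S scrambled by (intro exI[of _ S]) simp
qed

end
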